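(* Let $R$ be a commutative ring with unity that has at least one nontrivial idempotent. Then: (i) If $|U(R)|=1$, then $\beta(\mathrm{Cl}(R)_{SR})=\beta(\mathrm{Cl}_2(R)_{SR})=1$. (ii) If $|U(R)|\ge 2$ and $U''(R)=\emptyset$, then $\beta(\mathrm{Cl}(R)_{SR})=\beta(\mathrm{Cl}_2(R)_{SR})+1$. (iii) If $|U''(R)|=2$, then $\beta(\mathrm{Cl}(R)_{SR})=\beta(\mathrm{Cl}_2(R)_{SR})$. (iv) If $|U''(R)|>2$ and $\max\{2|\mathrm{Id}_\perp(R)^*|,|\mathrm{Id}(R)^*|\}=|\mathrm{Id}(R)^*|$, then $\beta(\mathrm{Cl}(R)_{SR})=\beta(\mathrm{Cl}_2(R)_{SR})$. (v) If $|U''(R)|>2$ and $\max\{2|\mathrm{Id}_\perp(R)^*|,|\mathrm{Id}(R)^*|\}=2|\mathrm{Id}_\perp(R)^*|$, then $\beta(\mathrm{Cl}(R)_{SR})=\beta(\mathrm{Cl}_2(R)_{SR})-1$.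
   Context: All rings are commutative with unity. $U(R)$ is the set of units, $\mathrm{Id}(R)$ the set of idempotents, $\mathrm{Id}(R)^*=\mathrm{Id}(R)\setminus\{0,1\}$; $\mathrm{Id}_\perp(R)$ denotes a set of pairwise orthogonal idempotents ($ef=0$ for distinct members) of maximum cardinality and $\mathrm{Id}_\perp(R)^*=\mathrm{Id}_\perp(R)\setminus\{0\}$. $U'(R)=\{u\in U(R):u^2=1\}$, $U''(R)=U(R)\setminus U'(R)$. The clean graph $\mathrm{Cl}(R)$ has vertex set $\{(e,u): e\in\mathrm{Id}(R), u\in U(R)\}$, two distinct vertices $(e,u),(f,v)$ being adjacent iff $ef=0$ or $uv=1$; $\mathrm{Cl}_2(R)$ is its subgraph induced by the vertices with $e\neq 0$. In a connected graph $\Gamma$ with distance $d$ and neighbourhoods $N(x)$, $x$ is maximally distant from $y$ if $d(y,w)\le d(x,y)$ for all $w\in N(x)$, and $x,y$ are mutually maximally distant (MMD) if each is maximally distant from the other. The strong resolving graph $\Gamma_{SR}$ has as vertex set the vertices MMD with some vertex, two vertices adjacent iff MMD in $\Gamma$. $\beta$ denotes the independence number.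
   Formalization: Part (v) is proved only when 2|Id_⊥(R)*| > |Id(R)*|; in the tie (e.g. R = F4×F4×F2, where both independence numbers are 8) (v) as printed is false and contradicts (iv). All infinite cardinalities are identified with a single ∞. *)

theory Defs
  imports Complex_Main "HOL-Library.Extended_Nat"
begin

text \<open>Cardinalities and the independence number live in \<^typ>\<open>enat\<close>, so that rings need not be
  finite; there \<^prop>\<open>\<infinity> + 1 = (\<infinity> :: enat)\<close> and \<^prop>\<open>\<infinity> - 1 = (\<infinity> :: enat)\<close>.\<close>

definition ecard :: "'a set \<Rightarrow> enat" where
  "ecard A = (if finite A then enat (card A) else \<infinity>)"


section \<open>Simple graphs\<close>

text \<open>The edge set is a symmetric irreflexive relation on the vertices.\<close>

record 'v sgraph =
  verts :: "'v set"
  edges :: "('v \<times> 'v) set"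

definition induced_subgraph :: "'v sgraph \<Rightarrow> 'v set \<Rightarrow> 'v sgraph" where
  "induced_subgraph G W =
     \<lparr>verts = verts G \<inter> W, edges = edges G \<inter> (W \<times> W)\<rparr>"

definition nbhd :: "'v sgraph \<Rightarrow> 'v \<Rightarrow> 'v set" where
  "nbhd G x = {w. (x, w) \<in> edges G}"

text \<open>A pair lies in \<open>edges G ^^ n\<close> iff it is joined by a walk of length \<open>n\<close>.\<close>

definition gdist :: "'v sgraph \<Rightarrow> 'v \<Rightarrow> 'v \<Rightarrow> enat" where
  "gdist G x y = (INF n \<in> {n. (x, y) \<in> edges G ^^ n}. enat n)"

definition maximally_distant :: "'v sgraph \<Rightarrow> 'v \<Rightarrow> 'v \<Rightarrow> bool" where
  "maximally_distant G x y \<longleftrightarrow> (\<forall>w \<in> nbhd G x. gdist G y w \<le> gdist G x y)"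

definition MMD :: "'v sgraph \<Rightarrow> 'v \<Rightarrow> 'v \<Rightarrow> bool" where
  "MMD G x y \<longleftrightarrow> maximally_distant G x y \<and> maximally_distant G y x"

definition strong_resolving_graph :: "'v sgraph \<Rightarrow> 'v sgraph" where
  "strong_resolving_graph G =
     \<lparr>verts = {x \<in> verts G. \<exists>y \<in> verts G. MMD G x y},
      edges = {(x, y). x \<in> verts G \<and> y \<in> verts G \<and> x \<noteq> y \<and> MMD G x y}\<rparr>"

definition independent_set :: "'v sgraph \<Rightarrow> 'v set \<Rightarrow> bool" where
  "independent_set G S \<longleftrightarrow>
     S \<subseteq> verts G \<and> (\<forall>x \<in> S. \<forall>y \<in> S. (x, y) \<notin> edges G)"

definition independence_number :: "'v sgraph \<Rightarrow> enat" where
  "independence_number G = (SUP S \<in> {S. independent_set G S}. ecard S)"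


section \<open>Units and idempotents\<close>

definition ring_units :: "'a::comm_ring_1 set" where
  "ring_units = {u. u dvd 1}"

definition involutive_units :: "'a::comm_ring_1 set" where
  "involutive_units = {u \<in> ring_units. u ^ 2 = 1}"

definition noninvolutive_units :: "'a::comm_ring_1 set" where
  "noninvolutive_units = ring_units - involutive_units"

definition idempotents :: "'a::comm_ring_1 set" where
  "idempotents = {e. e * e = e}"

definition nontrivial_idempotents :: "'a::comm_ring_1 set" where
  "nontrivial_idempotents = idempotents - {0, 1}"

definition orthogonal_idempotents :: "'a::comm_ring_1 set \<Rightarrow> bool" where
  "orthogonal_idempotents P \<longleftrightarrow>
     P \<subseteq> idempotents \<and> (\<forall>e \<in> P. \<forall>f \<in> P. e \<noteq> f \<longrightarrow> e * f = 0)"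

definition maximum_orthogonal_idempotents :: "'a::comm_ring_1 set \<Rightarrow> bool" where
  "maximum_orthogonal_idempotents P \<longleftrightarrow>
     orthogonal_idempotents P \<and> (\<forall>Q :: 'a set. orthogonal_idempotents Q \<longrightarrow> ecard Q \<le> ecard P)"


section \<open>Clean graphs\<close>

definition clean_graph :: "('a::comm_ring_1 \<times> 'a) sgraph" where
  "clean_graph =
     \<lparr>verts = idempotents \<times> ring_units,
      edges = {((e, u), (f, v)) | e u f v.
                 e \<in> idempotents \<and> u \<in> ring_units \<and> f \<in> idempotents \<and> v \<in> ring_units \<and>
                 (e, u) \<noteq> (f, v) \<and> (e * f = 0 \<or> u * v = 1)}\<rparr>"

definition clean_graph2 :: "('a::comm_ring_1 \<times> 'a) sgraph" where
  "clean_graph2 = induced_subgraph clean_graph {(e, u). e \<noteq> 0}"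

end

theory Submission
  imports Defs
begin

text \<open>When there are at least two units, no two vertices of \<open>Cl\<^sub>2(R)\<close> have the same closed
  neighbourhood. Hence in \<open>Cl(R)\<^sub>S\<^sub>R\<close> the vertices \<open>(0, u)\<close> form a clique component and the other
  vertices are joined iff they are not adjacent in \<open>Cl(R)\<close>, so its independence number is one
  more than the clique number of \<open>Cl\<^sub>2(R)\<close>. In \<open>Cl\<^sub>2(R)\<close> the distance is at most 2, except that
  it is 3 between \<open>(1, u)\<close> and \<open>(1, v)\<close> when \<open>u \<noteq> v\<close> and \<open>uv \<noteq> 1\<close>; consequently the strong
  resolving graph loses exactly the pairs \<open>(1, u)\<close>, \<open>(f, v)\<close> with \<open>f \<noteq> 1\<close> and \<open>u \<noteq> v\<close>, and an
  independent set consists of a clique of vertices with nontrivial idempotents together with one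
  vertex \<open>(1, u)\<close> or two vertices \<open>(1, u)\<close>, \<open>(1, u\<inverse>)\<close>, subject to \<open>u\<close> and \<open>u\<inverse>\<close> not occurring in
  the clique when \<open>u\<^sup>2 \<noteq> 1\<close>. Cliques are bounded by counting their fibres over the idempotents:
  with \<open>n\<close> the maximal number of orthogonal nonzero idempotents and \<open>N\<close> the number of nontrivial
  idempotents, a clique over nontrivial idempotents has at most \<open>max (2n) N\<close> elements.\<close>

section \<open>Distances and mutually maximally distant vertices\<close>

lemma gdist_le_iff: "gdist G x y \<le> enat n \<longleftrightarrow> (\<exists>m\<le>n. (x, y) \<in> edges G ^^ m)"
proof
  assume "gdist G x y \<le> enat n"
  \<comment> \<open>An infimum can be unfolded into a witness only from a strict bound, and among
    values of \<open>enat\<close> being at most \<open>n\<close> is the same as being below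
    \<open>Suc n\<close>.\<close>
  then have "gdist G x y < enat (Suc n)"
    by (rule le_less_trans) simp
  then show "\<exists>m\<le>n. (x, y) \<in> edges G ^^ m"
    unfolding gdist_def by (auto simp: INF_less_iff less_Suc_eq_le)
next
  assume "\<exists>m\<le>n. (x, y) \<in> edges G ^^ m"
  then obtain m where "m \<le> n" "(x, y) \<in> edges G ^^ m" by blast
  then show "gdist G x y \<le> enat n"
    unfolding gdist_def by (intro INF_lower2[of m]) auto
qed

lemma gdist_le_0_iff: "gdist G x y \<le> enat 0 \<longleftrightarrow> x = y"
  by (auto simp: gdist_le_iff)

text \<open>Splitting off the first edge of a walk turns the bounds 1, 2 and 3 into plain statements
  about edges, so no distance is ever computed exactly.\<close>

lemma gdist_le_Suc_iff:
  "gdist G x y \<le> enat (Suc n) \<longleftrightarrow> x = y \<or> (\<exists>z. (x, z) \<in> edges G \<and> gdist G z y \<le> enat n)"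
proof -
  have "(\<exists>m\<le>Suc n. (x, y) \<in> edges G ^^ m) \<longleftrightarrow>
    (x, y) \<in> edges G ^^ 0 \<or> (\<exists>m\<le>n. (x, y) \<in> edges G ^^ Suc m)"
    by (metis Suc_le_mono le0 not0_implies_Suc relpow.simps(1))
  also have "\<dots> \<longleftrightarrow> x = y \<or> (\<exists>z. (x, z) \<in> edges G \<and> (\<exists>m\<le>n. (z, y) \<in> edges G ^^ m))"
    unfolding relpow.simps relpow_commute[symmetric] by auto
  finally show ?thesis by (simp only: gdist_le_iff)
qed

lemma gdist_le_1_iff: "gdist G x y \<le> enat 1 \<longleftrightarrow> x = y \<or> (x, y) \<in> edges G"
  unfolding One_nat_def gdist_le_Suc_iff gdist_le_0_iff by auto

lemma gdist_le_2_iff: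
  "gdist G x y \<le> enat 2 \<longleftrightarrow>
     x = y \<or> (x, y) \<in> edges G \<or> (\<exists>z. (x, z) \<in> edges G \<and> (z, y) \<in> edges G)"
  unfolding numeral_2_eq_2 gdist_le_Suc_iff gdist_le_0_iff by auto

lemma gdist_ge_Suc_iff: "enat (Suc n) \<le> gdist G x y \<longleftrightarrow> \<not> gdist G x y \<le> enat n"
  by (simp add: Suc_ile_eq not_le)

lemma gdist_commute:
  assumes "sym (edges G)"
  shows "gdist G x y = gdist G y x"
proof -
  have "(a, b) \<in> edges G ^^ n" if "(b, a) \<in> edges G ^^ n" for a b n
    using that
  proof (induction n arbitrary: a b)
    case (Suc n)
    then show ?case by (metis assms relpow_Suc_E relpow_Suc_I2 symD)
  qed auto
  then have "{n. (x, y) \<in> edges G ^^ n} = {n. (y, x) \<in> edges G ^^ n}" by blast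
  then show ?thesis by (simp add: gdist_def)
qed

lemma MMD_commute: "MMD G x y \<longleftrightarrow> MMD G y x"
  by (auto simp: MMD_def)

text \<open>The number \<open>n\<close> separates the two sides of the comparison: it bounds the
  distance of \<open>x\<close> and \<open>y\<close> from below and all competing distances to
  neighbours from above.\<close>

lemma MMD_I:
  assumes "sym (edges G)" "enat n \<le> gdist G x y"
    and "\<And>w. (x, w) \<in> edges G \<Longrightarrow> gdist G y w \<le> enat n"
    and "\<And>w. (y, w) \<in> edges G \<Longrightarrow> gdist G x w \<le> enat n"
  shows "MMD G x y"
  using assms gdist_commute[OF assms(1), of x y]
  unfolding MMD_def maximally_distant_def nbhd_def by (auto intro: order_trans)

lemma not_MMD_I:
  assumes "gdist G x y \<le> enat n" "(x, w) \<in> edges G" "enat (Suc n) \<le> gdist G y w"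
  shows "\<not> MMD G x y"
proof
  assume "MMD G x y"
  then have "gdist G y w \<le> gdist G x y"
    using assms(2) by (auto simp: MMD_def maximally_distant_def nbhd_def)
  then have "enat (Suc n) \<le> enat n" using assms by (meson order_trans)
  then show False by simp
qed

text \<open>The neighbour \<open>w\<close> of \<open>x\<close> is at distance at least 2 from
  \<open>y\<close>, while \<open>x\<close> is at distance at most 1. So adjacent vertices are MMD
  only if they have the same closed neighbourhood.\<close>

lemma not_MMD_adjacentI:
  assumes "(x, y) \<in> edges G" "(x, w) \<in> edges G" "w \<noteq> y" "(y, w) \<notin> edges G"
  shows "\<not> MMD G x y"
proof (rule not_MMD_I[of _ _ _ 1 w])
  show "gdist G x y \<le> enat 1" using assms unfolding gdist_le_1_iff by blast
  show "enat (Suc 1) \<le> gdist G y w"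
    using assms unfolding gdist_ge_Suc_iff gdist_le_1_iff by blast
qed fact

section \<open>Bounds for independence numbers\<close>

lemma independence_number_leI:
  assumes "\<And>S. independent_set G S \<Longrightarrow> ecard S \<le> k"
  shows "independence_number G \<le> k"
  unfolding independence_number_def using assms by (auto intro: SUP_least)

lemma independence_number_geI:
  assumes "independent_set G S"
  shows "ecard S \<le> independence_number G"
  unfolding independence_number_def using assms by (auto intro: SUP_upper)

lemma ecard_subset_insert_le:
  assumes "S \<subseteq> insert z K" "finite K" "card K \<le> k"
  shows "ecard S \<le> enat (Suc k)"
proof -
  have "finite S" using assms finite_subset by blast
  have "card S \<le> card (insert z K)" using assms by (intro card_mono) auto
  also have "\<dots> \<le> Suc (card K)" by (simp add: card_insert_if assms)
  finally show ?thesis using assms \<open>finite S\<close> by (simp add: ecard_def)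
qed

text \<open>All distances between distinct vertices are 1, so the strong resolving graph is complete
  again. The vertex \<open>b\<close> is the MMD partner that puts \<open>a\<close> into it.\<close>

lemma independence_number_SR_complete:
  assumes complete: "\<And>x y. (x, y) \<in> edges G \<longleftrightarrow> x \<in> verts G \<and> y \<in> verts G \<and> x \<noteq> y"
    and ab: "a \<in> verts G" "b \<in> verts G" "a \<noteq> b"
  shows "independence_number (strong_resolving_graph G) = 1"
proof (rule antisym)
  have MMD: "MMD G x y" if "x \<in> verts G" "y \<in> verts G" "x \<noteq> y" for x y
  proof (rule MMD_I[of _ 1])
    show "sym (edges G)" by (auto simp: sym_def complete)
    show "enat 1 \<le> gdist G x y"
      using that unfolding One_nat_def gdist_ge_Suc_iff gdist_le_0_iff by blast
  qed (use that in \<open>auto simp: gdist_le_1_iff complete simp del: One_nat_def\<close>)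
  show "independence_number (strong_resolving_graph G) \<le> 1"
  proof (rule independence_number_leI)
    fix S assume "independent_set (strong_resolving_graph G) S"
    then have "x = y" if "x \<in> S" "y \<in> S" for x y
      using that MMD unfolding independent_set_def strong_resolving_graph_def by simp blast
    then have "S = {} \<or> (\<exists>x. S = {x})" by blast
    then show "ecard S \<le> 1" by (auto simp: ecard_def one_enat_def)
  qed
  have "independent_set (strong_resolving_graph G) {a}"
    using ab MMD unfolding independent_set_def strong_resolving_graph_def by auto
  from independence_number_geI[OF this]
  show "1 \<le> independence_number (strong_resolving_graph G)"
    by (simp add: ecard_def one_enat_def)
qed

section \<open>Units and idempotents\<close>

lemma unit_inverse:
  assumes "(u::'a::comm_ring_1) \<in> ring_units"
  obtains u' where "u' \<in> ring_units" "u * u' = 1"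
  using assms unfolding ring_units_def by (metis dvd_def dvd_triv_right mem_Collect_eq)

lemma inverse_unique: "(u::'a::comm_ring_1) * v = 1 \<Longrightarrow> u * w = 1 \<Longrightarrow> v = w"
  by (metis mult.assoc mult.commute mult.right_neutral)

lemma one_in_ring_units [simp]: "1 \<in> ring_units"
  by (simp add: ring_units_def)

lemma noninvolutive_units_iff:
  "u \<in> noninvolutive_units \<longleftrightarrow> u \<in> ring_units \<and> u * u \<noteq> (1::'a::comm_ring_1)"
  by (auto simp: noninvolutive_units_def involutive_units_def power2_eq_square)

lemma noninvolutive_inverse_pair:
  fixes u v :: "'a::comm_ring_1"
  assumes "u \<in> noninvolutive_units" "v \<in> ring_units" "u * v = 1"
  shows "u \<in> ring_units" "u \<noteq> v" "u \<noteq> 1" "v \<noteq> 1" "v \<in> noninvolutive_units"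
proof -
  show "u \<in> ring_units" "u \<noteq> v" "u \<noteq> 1" "v \<noteq> 1"
    using assms by (auto simp: noninvolutive_units_iff)
  then show "v \<in> noninvolutive_units"
    using assms inverse_unique[of v u v] by (auto simp: noninvolutive_units_iff mult.commute)
qed

lemma zero_one_idempotents [simp]: "0 \<in> idempotents" "1 \<in> idempotents"
  by (auto simp: idempotents_def)

lemma idempotent_complement [simp]: "1 - e \<in> idempotents \<longleftrightarrow> (e::'a::comm_ring_1) \<in> idempotents"
  by (auto simp: idempotents_def algebra_simps)

lemma idempotent_mult_complement: "(e::'a::comm_ring_1) \<in> idempotents \<Longrightarrow> e * (1 - e) = 0"
  by (auto simp: idempotents_def algebra_simps)

lemma idempotent_mult_self: "(e::'a::comm_ring_1) \<in> idempotents \<Longrightarrow> e * e = e"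
  by (simp add: idempotents_def)

lemma nontrivial_idempotents_iff:
  "e \<in> nontrivial_idempotents \<longleftrightarrow> e \<in> idempotents \<and> e \<noteq> 0 \<and> e \<noteq> 1"
  by (auto simp: nontrivial_idempotents_def)

lemma finite_nontrivial_idempotents:
  "finite (idempotents :: 'a::comm_ring_1 set) \<Longrightarrow> finite (nontrivial_idempotents :: 'a set)"
  by (simp add: nontrivial_idempotents_def)

text \<open>If \<open>u\<close> is its own inverse, every other unit will do; otherwise
  \<open>w = 1\<close> will do. For \<open>e\<close> nonzero, the vertex \<open>(e, w)\<close> is
  then distinct from \<open>(e, u)\<close> and not adjacent to it.\<close>

lemma unit_avoiding_inverse_pair:
  fixes t u :: "'a::comm_ring_1"
  assumes "t \<in> ring_units" "t \<noteq> 1" "u \<in> ring_units"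
  obtains w where "w \<in> ring_units" "w \<noteq> u" "u * w \<noteq> 1"
proof (cases "u * u = 1")
  case True
  obtain w where "w \<in> ring_units" "w \<noteq> u"
    using assms by (metis one_in_ring_units)
  moreover have "u * w \<noteq> 1" using True \<open>w \<noteq> u\<close> inverse_unique[of u u w] by blast
  ultimately show ?thesis by (rule that)
next
  case False
  then have "u \<noteq> 1" by auto
  then show ?thesis using that[of 1] by auto
qed

section \<open>The strong resolving graphs\<close>

lemma verts_clean_graph: "verts clean_graph = idempotents \<times> ring_units"
  by (simp add: clean_graph_def)

lemma edges_clean_graph:
  "((e, u), (f, v)) \<in> edges clean_graph \<longleftrightarrow>
     (e::'a::comm_ring_1) \<in> idempotents \<and> u \<in> ring_units \<and> f \<in> idempotents \<and> v \<in> ring_units \<and>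
     (e, u) \<noteq> (f, v) \<and> (e * f = 0 \<or> u * v = 1)"
  by (auto simp: clean_graph_def)

lemma verts_clean_graph2: "verts clean_graph2 = (idempotents - {0}) \<times> ring_units"
  by (auto simp: clean_graph2_def induced_subgraph_def verts_clean_graph)

lemma edges_clean_graph2:
  "((e, u), (f, v)) \<in> edges clean_graph2 \<longleftrightarrow>
     ((e, u), (f, v)) \<in> edges clean_graph \<and> e \<noteq> 0 \<and> f \<noteq> 0"
  by (auto simp: clean_graph2_def induced_subgraph_def)

lemma sym_edges_clean_graph: "sym (edges (clean_graph :: ('a::comm_ring_1 \<times> 'a) sgraph))"
  by (auto simp: sym_def edges_clean_graph mult.commute)

lemma sym_edges_clean_graph2: "sym (edges (clean_graph2 :: ('a::comm_ring_1 \<times> 'a) sgraph))"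
  by (auto simp: sym_def edges_clean_graph2 edges_clean_graph mult.commute)

text \<open>The unit \<open>t\<close> expresses that there are at least two units; with a single
  unit both graphs are complete and are treated separately.\<close>

context
  fixes c t :: "'a::comm_ring_1"
  assumes c: "c \<in> nontrivial_idempotents"
    and t: "t \<in> ring_units" "t \<noteq> 1"
begin

text \<open>The third vertex \<open>z\<close> sees exactly one of the two adjacent vertices. By
  \<open>not_MMD_adjacentI\<close>, adjacent vertices with nonzero idempotents are therefore never
  MMD, in either graph.\<close>

lemma clean_graph2_no_twins:
  fixes e u f v :: 'a
  assumes "((e, u), (f, v)) \<in> edges clean_graph2"
  shows "\<exists>z. z \<noteq> (e, u) \<and> z \<noteq> (f, v) \<and>
    (((e, u), z) \<in> edges clean_graph2 \<and> ((f, v), z) \<notin> edges clean_graph2 \<or>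
     ((e, u), z) \<notin> edges clean_graph2 \<and> ((f, v), z) \<in> edges clean_graph2)"
proof -
  have mixed: "\<exists>z. z \<noteq> (1, u) \<and> z \<noteq> (f, v) \<and>
       ((1, u), z) \<notin> edges clean_graph2 \<and> ((f, v), z) \<in> edges clean_graph2"
    if f: "f \<in> nontrivial_idempotents" "v \<in> ring_units" "u \<in> ring_units" for u f v :: 'a
  proof -
    \<comment> \<open>In \<open>clean_graph2\<close> a neighbour of \<open>(1, u)\<close> must carry
      the inverse of \<open>u\<close>. As \<open>w\<close> is not that inverse,
      \<open>(1 - f, w)\<close> is adjacent to \<open>(f, v)\<close> only, by orthogonality.\<close>
    obtain w where w: "w \<in> ring_units" "w \<noteq> u" "u * w \<noteq> 1"
      using unit_avoiding_inverse_pair[OF t \<open>u \<in> ring_units\<close>] .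
    have "1 - f \<noteq> f" using f by (metis idempotent_mult_complement idempotent_mult_self nontrivial_idempotents_iff)
    with f w show ?thesis
      by (intro exI[of _ "(1 - f, w)"])
         (auto simp: edges_clean_graph2 edges_clean_graph nontrivial_idempotents_iff
            idempotent_mult_complement)
  qed
  have ef: "e \<in> idempotents" "f \<in> idempotents" "u \<in> ring_units" "v \<in> ring_units" "e \<noteq> 0" "f \<noteq> 0"
    "(e, u) \<noteq> (f, v)" "e * f = 0 \<or> u * v = 1"
    using assms by (auto simp: edges_clean_graph2 edges_clean_graph)
  consider "e = 1" "f = 1" | "e = 1" "f \<noteq> 1" | "e \<noteq> 1" "f = 1"
    | "e \<noteq> 1" "f \<noteq> 1" "u \<noteq> v" | "e \<noteq> 1" "f \<noteq> 1" "u = v" by blast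
  then show ?thesis
  proof cases
    case 1
    then have "u \<noteq> v" "u * v = 1" "v * v \<noteq> 1" using ef inverse_unique[of v u v] by (auto simp: mult.commute)
    then show ?thesis using 1 ef c
      by (intro exI[of _ "(c, v)"])
         (auto simp: edges_clean_graph2 edges_clean_graph nontrivial_idempotents_iff)
  next
    case 2
    then show ?thesis using mixed[of f v u] ef by (auto simp: nontrivial_idempotents_iff)
  next
    case 3
    then show ?thesis using mixed[of e u v] ef unfolding nontrivial_idempotents_iff by blast
  next
    case 4
    \<comment> \<open>With idempotent 1 only the units decide adjacency, and \<open>w\<close> is
      inverse to \<open>u\<close> but not to \<open>v\<close>.\<close>
    obtain w where w: "w \<in> ring_units" "u * w = 1" using unit_inverse[OF \<open>u \<in> ring_units\<close>] .
    then have "v * w \<noteq> 1" using 4 inverse_unique by (metis mult.commute)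
    then show ?thesis using 4 ef w
      by (intro exI[of _ "(1, w)"]) (auto simp: edges_clean_graph2 edges_clean_graph)
  next
    case 5
    then have "e \<noteq> f" using ef by auto
    obtain w where w: "w \<in> ring_units" "w \<noteq> u" "u * w \<noteq> 1"
      using unit_avoiding_inverse_pair[OF t \<open>u \<in> ring_units\<close>] .
    \<comment> \<open>If both products vanished, then \<open>f = e * f = e\<close>. The complement
      of one idempotent thus separates the two vertices, and the choice of \<open>w\<close> rules
      out adjacency through the units.\<close>
    have "f * (1 - e) \<noteq> 0 \<or> e * (1 - f) \<noteq> 0"
      using \<open>e \<noteq> f\<close> by (auto simp: algebra_simps)
    then show ?thesis
    proof
      assume "f * (1 - e) \<noteq> 0"
      then show ?thesis using 5 ef w
        by (intro exI[of _ "(1 - e, w)"])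
           (auto simp: edges_clean_graph2 edges_clean_graph idempotent_mult_complement)
    next
      assume "e * (1 - f) \<noteq> 0"
      then show ?thesis using 5 ef w
        by (intro exI[of _ "(1 - f, w)"])
           (auto simp: edges_clean_graph2 edges_clean_graph idempotent_mult_complement)
    qed
  qed
qed

text \<open>The vertex \<open>(0, 1)\<close> is a hub, so the diameter is at most 2 and nonadjacent
  vertices are MMD. Vertices over 0 are adjacent to everything, hence MMD with each other. Every
  other adjacent pair is separated by some third vertex.\<close>

lemma MMD_clean_graph_iff:
  fixes e u f v :: 'a
  assumes "e \<in> idempotents" "u \<in> ring_units" "f \<in> idempotents" "v \<in> ring_units" "(e, u) \<noteq> (f, v)"
  shows "MMD clean_graph (e, u) (f, v) \<longleftrightarrow> e * f \<noteq> 0 \<and> u * v \<noteq> 1 \<or> e = 0 \<and> f = 0"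
proof -
  let ?G = "clean_graph :: ('a \<times> 'a) sgraph"
  have diam: "gdist ?G x y \<le> enat 2" if "x \<in> verts ?G" "y \<in> verts ?G" for x y
  proof -
    obtain a p b q where xy: "x = (a, p)" "y = (b, q)" by fastforce
    show ?thesis
    proof (cases "x = y \<or> (x, y) \<in> edges ?G")
      case True
      then show ?thesis by (auto simp: gdist_le_2_iff)
    next
      case False
      then have "(x, (0, 1)) \<in> edges ?G" "((0, 1), y) \<in> edges ?G"
        using that unfolding xy by (auto simp: edges_clean_graph verts_clean_graph)
      then show ?thesis by (auto simp: gdist_le_2_iff)
    qed
  qed
  have in_verts: "x \<in> verts ?G" "y \<in> verts ?G" if "(x, y) \<in> edges ?G" for x y
    using that by (cases x; cases y; auto simp: edges_clean_graph verts_clean_graph)+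
  have V: "(e, u) \<in> verts ?G" "(f, v) \<in> verts ?G" using assms by (auto simp: verts_clean_graph)
  have zero: "\<not> MMD ?G (0, u) (f, v)"
    if "u \<in> ring_units" "v \<in> ring_units" "f \<in> idempotents" "f \<noteq> 0" for u f v :: 'a
  proof -
    \<comment> \<open>The vertex \<open>(f, w)\<close> is adjacent to \<open>(0, u)\<close> but not
      to \<open>(f, v)\<close>.\<close>
    obtain w where w: "w \<in> ring_units" "w \<noteq> v" "v * w \<noteq> 1"
      using unit_avoiding_inverse_pair[OF t \<open>v \<in> ring_units\<close>] .
    then show ?thesis using that
      by (intro not_MMD_adjacentI[of _ _ _ "(f, w)"]) (auto simp: edges_clean_graph idempotent_mult_self)
  qed
  consider "e * f \<noteq> 0" "u * v \<noteq> 1" | "e = 0" "f = 0" | "e = 0" "f \<noteq> 0" | "e \<noteq> 0" "f = 0"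
    | "e \<noteq> 0" "f \<noteq> 0" "e * f = 0 \<or> u * v = 1" by blast
  then show ?thesis
  proof cases
    case 1
    have "enat (Suc 1) \<le> gdist ?G (e, u) (f, v)"
      using 1 assms unfolding gdist_ge_Suc_iff gdist_le_1_iff by (auto simp: edges_clean_graph)
    then have "MMD ?G (e, u) (f, v)"
      by (intro MMD_I[of _ 2] sym_edges_clean_graph diam V)
         (auto simp: numeral_2_eq_2 dest: in_verts)
    then show ?thesis using 1 by simp
  next
    case 2
    have "enat (Suc 0) \<le> gdist ?G (e, u) (f, v)"
      using assms unfolding gdist_ge_Suc_iff gdist_le_0_iff by auto
    moreover have "gdist ?G (0, p) w \<le> enat 1" if "p \<in> ring_units" "w \<in> verts ?G" for p w
      using that by (cases w) (auto simp: gdist_le_1_iff edges_clean_graph verts_clean_graph simp del: One_nat_def)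
    ultimately have "MMD ?G (e, u) (f, v)"
      using 2 assms by (intro MMD_I[of _ 1] sym_edges_clean_graph) (auto dest: in_verts)
    then show ?thesis using 2 by simp
  next
    case 3
    then show ?thesis using zero assms by auto
  next
    case 4
    then show ?thesis using zero[of v u e] assms by (auto simp: MMD_commute)
  next
    case 5
    then have adj: "((e, u), (f, v)) \<in> edges clean_graph2"
      using assms by (auto simp: edges_clean_graph2 edges_clean_graph)
    \<comment> \<open>As an endpoint of an edge of \<open>clean_graph2\<close>, the separating
      vertex has \<open>g\<close> nonzero. Hence its edges and non-edges to the given vertices are
      the same in \<open>clean_graph\<close>.\<close>
    then obtain g w where z: "(g, w) \<noteq> (e, u)" "(g, w) \<noteq> (f, v)"
      "((e, u), (g, w)) \<in> edges clean_graph2 \<and> ((f, v), (g, w)) \<notin> edges clean_graph2 \<or>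
       ((e, u), (g, w)) \<notin> edges clean_graph2 \<and> ((f, v), (g, w)) \<in> edges clean_graph2"
      using clean_graph2_no_twins[OF adj] by (metis surj_pair)
    have adj': "((e, u), (f, v)) \<in> edges ?G" "((f, v), (e, u)) \<in> edges ?G"
      using adj sym_edges_clean_graph by (auto simp: edges_clean_graph2 dest: symD)
    have "\<not> MMD ?G (e, u) (f, v)"
      using z(3)
    proof
      assume "((e, u), (g, w)) \<in> edges clean_graph2 \<and> ((f, v), (g, w)) \<notin> edges clean_graph2"
      then show ?thesis using adj' z 5
        by (intro not_MMD_adjacentI[of _ _ _ "(g, w)"]) (auto simp: edges_clean_graph2)
    next
      assume "((e, u), (g, w)) \<notin> edges clean_graph2 \<and> ((f, v), (g, w)) \<in> edges clean_graph2"
      then have "\<not> MMD ?G (f, v) (e, u)" using adj' z 5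
        by (intro not_MMD_adjacentI[of _ _ _ "(g, w)"]) (auto simp: edges_clean_graph2)
      then show ?thesis by (simp add: MMD_commute)
    qed
    then show ?thesis using 5 by auto
  qed
qed

text \<open>A vertex with nontrivial idempotent has eccentricity at most 2; only two vertices over 1
  can be at distance 3. A nonadjacent mixed pair \<open>(1, u)\<close>, \<open>(f, v)\<close> fails
  to be MMD exactly when the neighbour of \<open>(f, v)\<close> over 1, whose unit is inverse to
  \<open>v\<close>, is at distance 3 from \<open>(1, u)\<close>, that is, when \<open>u\<close> and
  \<open>v\<close> differ.\<close>

lemma MMD_clean_graph2_iff:
  fixes e u f v :: 'a
  assumes "e \<in> idempotents - {0}" "u \<in> ring_units" "f \<in> idempotents - {0}" "v \<in> ring_units"
    and "(e, u) \<noteq> (f, v)"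
  shows "MMD clean_graph2 (e, u) (f, v) \<longleftrightarrow>
    e * f \<noteq> 0 \<and> u * v \<noteq> 1 \<and> ((e = 1) = (f = 1) \<or> u = v)"
proof -
  let ?G = "clean_graph2 :: ('a \<times> 'a) sgraph"
  note edge_iff = edges_clean_graph2 edges_clean_graph
  note symG = sym_edges_clean_graph2[where ?'a = 'a]
  have in_verts: "x \<in> verts ?G" "y \<in> verts ?G" if "(x, y) \<in> edges ?G" for x y
    using that by (cases x; cases y; auto simp: edge_iff verts_clean_graph2)+
  have near: "gdist ?G (e, u) x \<le> enat 2"
    if "e \<in> nontrivial_idempotents" "u \<in> ring_units" "x \<in> verts ?G" for e u x
  proof -
    obtain f v where x: "x = (f, v)" by fastforce
    have fv: "f \<in> idempotents" "f \<noteq> 0" "v \<in> ring_units"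
      using that x by (auto simp: verts_clean_graph2)
    \<comment> \<open>The midpoint \<open>(1 - e, w)\<close> is joined to \<open>(e, u)\<close> by
      orthogonality and to \<open>(f, v)\<close> by inverse units.\<close>
    obtain w where w: "w \<in> ring_units" "v * w = 1" using unit_inverse[OF \<open>v \<in> ring_units\<close>] .
    have "1 - e \<noteq> e"
      using that by (metis idempotent_mult_complement idempotent_mult_self nontrivial_idempotents_iff)
    moreover have "e * (1 - e) = 0" "(1 - e) * e = 0" "1 - e \<noteq> 0" "1 - e \<in> idempotents"
      using that idempotent_mult_complement[of e]
      by (auto simp: nontrivial_idempotents_iff mult.commute)
    moreover have "w * v = 1" using w by (simp add: mult.commute)
    ultimately have z: "((e, u), (1 - e, w)) \<in> edges ?G \<and> ((1 - e, w), (f, v)) \<in> edges ?G"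
      if "e * f \<noteq> 0"
      using that fv w \<open>u \<in> ring_units\<close> \<open>e \<in> nontrivial_idempotents\<close>
      unfolding edge_iff nontrivial_idempotents_iff by auto
    have "(e, u) = x \<or> ((e, u), x) \<in> edges ?G" if "e * f = 0"
      using that fv \<open>u \<in> ring_units\<close> \<open>e \<in> nontrivial_idempotents\<close>
      unfolding edge_iff nontrivial_idempotents_iff x by blast
    with z show ?thesis unfolding gdist_le_2_iff x by metis
  qed
  have near': "gdist ?G x (e, u) \<le> enat 2"
    if "e \<in> nontrivial_idempotents" "u \<in> ring_units" "x \<in> verts ?G" for e u x
    using near[OF that] gdist_commute[OF symG, of x] by simp
  have diam: "gdist ?G x y \<le> enat 3" if "x \<in> verts ?G" "y \<in> verts ?G" for x y
  proof -
    obtain e u where x: "x = (e, u)" by fastforce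
    show ?thesis
    proof (cases "e = 1")
      case True
      have "u \<in> ring_units" using that x by (auto simp: verts_clean_graph2)
      then obtain w where w: "w \<in> ring_units" "u * w = 1" using unit_inverse by blast
      then have "(x, (c, w)) \<in> edges ?G"
        using that c x True by (auto simp: edge_iff nontrivial_idempotents_iff verts_clean_graph2)
      moreover have "gdist ?G (c, w) y \<le> enat 2" using near c w that by blast
      ultimately have "gdist ?G x y \<le> enat (Suc 2)" unfolding gdist_le_Suc_iff by blast
      then show ?thesis by simp
    next
      case False
      then have "gdist ?G x y \<le> enat 2"
        using near that x by (auto simp: nontrivial_idempotents_iff verts_clean_graph2)
      then show ?thesis by (rule order_trans) simp
    qed
  qed
  \<comment> \<open>A common neighbour would carry a unit inverse to both \<open>u\<close> and
    \<open>v\<close>.\<close>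
  have far: "enat (Suc 2) \<le> gdist ?G (1, u) (1, v)" if "u \<noteq> v" "u * v \<noteq> 1" for u v
  proof -
    have "u = v" if "u * w = 1" "w * v = 1" for w
      using that inverse_unique[of w u v] by (simp add: mult.commute)
    then show ?thesis using that
      unfolding gdist_ge_Suc_iff gdist_le_2_iff by (auto simp: edge_iff)
  qed
  have mixed: "MMD ?G (1, u) (f, v) \<longleftrightarrow> u = v"
    if "u \<in> ring_units" "v \<in> ring_units" "f \<in> nontrivial_idempotents" "u * v \<noteq> 1" for u f v
  proof
    assume "u = v"
    show "MMD ?G (1, u) (f, v)"
    proof (rule MMD_I[of _ 2])
      show "enat 2 \<le> gdist ?G (1, u) (f, v)"
        using that gdist_ge_Suc_iff[of 1 ?G "(1, u)" "(f, v)"]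
        unfolding gdist_le_1_iff by (auto simp: edge_iff nontrivial_idempotents_iff numeral_2_eq_2)
      show "gdist ?G (f, v) w \<le> enat 2" if "((1, u), w) \<in> edges ?G" for w
        using near in_verts[OF that] \<open>v \<in> ring_units\<close> \<open>f \<in> nontrivial_idempotents\<close> by blast
      show "gdist ?G (1, u) w \<le> enat 2" if w: "((f, v), w) \<in> edges ?G" for w
      proof -
        obtain g p where gp: "w = (g, p)" by fastforce
        show ?thesis
        proof (cases "g = 1")
          case True
          \<comment> \<open>A neighbour of \<open>(f, v)\<close> over 1 carries the inverse of
            \<open>v\<close>. Since \<open>u = v\<close>, it is near \<open>(1, u)\<close> as
            well.\<close>
          then have "v * p = 1" using w gp that \<open>f \<in> nontrivial_idempotents\<close>
            by (auto simp: edge_iff nontrivial_idempotents_iff)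
          then show ?thesis using w gp \<open>u = v\<close> unfolding gdist_le_2_iff by (auto simp: edge_iff)
        next
          case False
          then show ?thesis using w gp \<open>u \<in> ring_units\<close>
            by (auto intro!: near' simp: edge_iff nontrivial_idempotents_iff verts_clean_graph2)
        qed
      qed
    qed (rule symG)
  next
    assume MMD: "MMD ?G (1, u) (f, v)"
    show "u = v"
    proof (rule ccontr)
      assume "u \<noteq> v"
      \<comment> \<open>The neighbour \<open>(1, w)\<close> of \<open>(f, v)\<close> is at distance
        3 from \<open>(1, u)\<close>: \<open>u = w\<close> would give \<open>u * v = 1\<close>, and
        \<open>u * w = 1\<close> would give \<open>u = v\<close>.\<close>
      obtain w where w: "w \<in> ring_units" "v * w = 1" using unit_inverse[OF \<open>v \<in> ring_units\<close>] .
      then have "u \<noteq> w" "u * w \<noteq> 1"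
        using \<open>u \<noteq> v\<close> \<open>u * v \<noteq> 1\<close> inverse_unique[of w u v] by (auto simp: mult.commute)
      then have "enat (Suc 2) \<le> gdist ?G (1, u) (1, w)" by (rule far)
      moreover have "gdist ?G (f, v) (1, u) \<le> enat 2"
        using near that by (auto simp: verts_clean_graph2)
      moreover have "((f, v), (1, w)) \<in> edges ?G"
        using that w by (auto simp: edge_iff nontrivial_idempotents_iff)
      ultimately have "\<not> MMD ?G (f, v) (1, u)" by (intro not_MMD_I)
      with MMD show False by (simp add: MMD_commute)
    qed
  qed
  have nontriv: "a \<in> nontrivial_idempotents" if "a \<in> idempotents - {0}" "a \<noteq> 1" for a :: 'a
    using that by (auto simp: nontrivial_idempotents_iff)
  consider "e * f = 0 \<or> u * v = 1" | "e * f \<noteq> 0" "u * v \<noteq> 1" "e \<noteq> 1" "f \<noteq> 1"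
    | "u * v \<noteq> 1" "e = 1" "f = 1" | "u * v \<noteq> 1" "e = 1" "f \<noteq> 1" | "u * v \<noteq> 1" "e \<noteq> 1" "f = 1"
    by blast
  then show ?thesis
  proof cases
    case 1
    then have adj: "((e, u), (f, v)) \<in> edges ?G" using assms by (auto simp: edge_iff)
    then have adj': "((f, v), (e, u)) \<in> edges ?G" using symG by (auto dest: symD)
    from clean_graph2_no_twins[OF adj] not_MMD_adjacentI[OF adj] not_MMD_adjacentI[OF adj']
    have "\<not> MMD ?G (e, u) (f, v)" unfolding MMD_commute[of _ "(f, v)"] by metis
    then show ?thesis using 1 by auto
  next
    case 2
    have "enat (Suc 1) \<le> gdist ?G (e, u) (f, v)"
      using 2 assms unfolding gdist_ge_Suc_iff gdist_le_1_iff by (auto simp: edge_iff)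
    then have "MMD ?G (e, u) (f, v)"
      using 2 assms nontriv
      by (intro MMD_I[of _ 2] symG near) (auto simp: numeral_2_eq_2 dest: in_verts)
    then show ?thesis using 2 by simp
  next
    case 3
    then have "enat (Suc 2) \<le> gdist ?G (e, u) (f, v)" using assms far by simp
    then have "MMD ?G (e, u) (f, v)"
      using assms
      by (intro MMD_I[of _ 3] symG diam) (auto simp: verts_clean_graph2 dest: in_verts)
    then show ?thesis using 3 assms by auto
  next
    case 4
    then show ?thesis using mixed[of u v f] nontriv assms by auto
  next
    case 5
    then show ?thesis using mixed[of v u e] nontriv assms
      by (auto simp: MMD_commute[of _ _ "(1, v)"] mult.commute)
  qed
qed

text \<open>The condition on pairs negates the MMD criterion. No vertex is lost in the strong
  resolving graph, since \<open>(e, u)\<close> is MMD with some \<open>(e, w)\<close>.\<close>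

lemma independent_set_SR_clean_graph_iff:
  "independent_set (strong_resolving_graph clean_graph) (S :: ('a \<times> 'a) set) \<longleftrightarrow>
     S \<subseteq> idempotents \<times> ring_units \<and>
     (\<forall>(e, u) \<in> S. \<forall>(f, v) \<in> S. (e, u) \<noteq> (f, v) \<longrightarrow> (e * f = 0 \<or> u * v = 1) \<and> (e \<noteq> 0 \<or> f \<noteq> 0))"
proof -
  have "\<exists>y \<in> verts clean_graph. MMD clean_graph (e, u) y"
    if "e \<in> idempotents" "u \<in> ring_units" for e u :: 'a
  proof -
    obtain w where w: "w \<in> ring_units" "w \<noteq> u" "u * w \<noteq> 1"
      using unit_avoiding_inverse_pair[OF t \<open>u \<in> ring_units\<close>] .
    then show ?thesis using that MMD_clean_graph_iff[of e u e w]
      by (intro bexI[of _ "(e, w)"]) (auto simp: verts_clean_graph idempotent_mult_self)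
  qed
  then have V: "verts (strong_resolving_graph clean_graph) = (idempotents :: 'a set) \<times> ring_units"
    by (auto simp: strong_resolving_graph_def verts_clean_graph)
  have E: "((e, u), (f, v)) \<in> edges (strong_resolving_graph clean_graph) \<longleftrightarrow>
     (e, u) \<noteq> (f, v) \<and> (e * f \<noteq> 0 \<and> u * v \<noteq> 1 \<or> e = 0 \<and> f = 0)"
    if "e \<in> idempotents" "u \<in> ring_units" "f \<in> idempotents" "v \<in> ring_units" for e u f v :: 'a
    using that MMD_clean_graph_iff[OF that]
    by (auto simp: strong_resolving_graph_def verts_clean_graph)
  show ?thesis
  proof (cases "S \<subseteq> idempotents \<times> ring_units")
    case True
    then have "((e, u), (f, v)) \<in> edges (strong_resolving_graph clean_graph) \<longleftrightarrow>
     (e, u) \<noteq> (f, v) \<and> (e * f \<noteq> 0 \<and> u * v \<noteq> 1 \<or> e = 0 \<and> f = 0)"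
      if "(e, u) \<in> S" "(f, v) \<in> S" for e u f v using that by (intro E) auto
    with True show ?thesis unfolding independent_set_def V by (simp add: Ball_def split_paired_All) blast
  qed (simp add: independent_set_def V)
qed

lemma independent_set_SR_clean_graph2_iff:
  "independent_set (strong_resolving_graph clean_graph2) (S :: ('a \<times> 'a) set) \<longleftrightarrow>
     S \<subseteq> (idempotents - {0}) \<times> ring_units \<and>
     (\<forall>(e, u) \<in> S. \<forall>(f, v) \<in> S. (e, u) \<noteq> (f, v) \<longrightarrow>
        e * f = 0 \<or> u * v = 1 \<or> (e = 1) \<noteq> (f = 1) \<and> u \<noteq> v)"
proof -
  have "\<exists>y \<in> verts clean_graph2. MMD clean_graph2 (e, u) y"
    if "e \<in> idempotents - {0}" "u \<in> ring_units" for e u :: 'a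
  proof -
    obtain w where w: "w \<in> ring_units" "w \<noteq> u" "u * w \<noteq> 1"
      using unit_avoiding_inverse_pair[OF t \<open>u \<in> ring_units\<close>] .
    then show ?thesis using that MMD_clean_graph2_iff[of e u e w]
      by (intro bexI[of _ "(e, w)"]) (auto simp: verts_clean_graph2 idempotent_mult_self)
  qed
  then have V: "verts (strong_resolving_graph clean_graph2) = ((idempotents :: 'a set) - {0}) \<times> ring_units"
    by (auto simp: strong_resolving_graph_def verts_clean_graph2)
  have E: "((e, u), (f, v)) \<in> edges (strong_resolving_graph clean_graph2) \<longleftrightarrow>
     (e, u) \<noteq> (f, v) \<and> e * f \<noteq> 0 \<and> u * v \<noteq> 1 \<and> ((e = 1) = (f = 1) \<or> u = v)"
    if "e \<in> idempotents - {0}" "u \<in> ring_units" "f \<in> idempotents - {0}" "v \<in> ring_units"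
    for e u f v :: 'a
    using that MMD_clean_graph2_iff[OF that]
    by (auto simp: strong_resolving_graph_def verts_clean_graph2)
  show ?thesis
  proof (cases "S \<subseteq> (idempotents - {0}) \<times> ring_units")
    case True
    then have "((e, u), (f, v)) \<in> edges (strong_resolving_graph clean_graph2) \<longleftrightarrow>
       (e, u) \<noteq> (f, v) \<and> e * f \<noteq> 0 \<and> u * v \<noteq> 1 \<and> ((e = 1) = (f = 1) \<or> u = v)"
      if "(e, u) \<in> S" "(f, v) \<in> S" for e u f v using that by (intro E) auto
    with True show ?thesis unfolding independent_set_def V by (simp add: Ball_def split_paired_All) blast
  qed (simp add: independent_set_def V)
qed

end

section \<open>Cliques of the clean graph\<close>

text \<open>These are the cliques of \<open>clean_graph2\<close>. Vertices over 0 are left out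
  because an independent set contains at most one of them, which is counted separately.\<close>

definition clean_clique :: "('a::comm_ring_1 \<times> 'a) set \<Rightarrow> bool" where
  "clean_clique K \<longleftrightarrow> K \<subseteq> (idempotents - {0}) \<times> ring_units \<and>
     (\<forall>(e, u) \<in> K. \<forall>(f, v) \<in> K. (e, u) \<noteq> (f, v) \<longrightarrow> e * f = 0 \<or> u * v = 1)"

lemma clean_clique_mem:
  "clean_clique K \<Longrightarrow> (e, u) \<in> K \<Longrightarrow> e \<in> idempotents \<and> e \<noteq> 0 \<and> u \<in> ring_units"
  by (auto simp: clean_clique_def)

lemma clean_cliqueD:
  "clean_clique K \<Longrightarrow> (e, u) \<in> K \<Longrightarrow> (f, v) \<in> K \<Longrightarrow> (e, u) \<noteq> (f, v) \<Longrightarrow> e * f = 0 \<or> u * v = 1"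
  unfolding clean_clique_def Ball_def split_paired_All prod.case by blast

text \<open>A nonzero idempotent is not orthogonal to itself, so adjacency within a fibre comes from
  the units. Inverses being unique, a fibre has at most two elements.\<close>

lemma clean_clique_fibre:
  assumes "clean_clique K" "(e, u) \<in> K" "(e, v) \<in> K" "u \<noteq> v"
  shows "u * v = 1"
  using clean_cliqueD[OF assms(1-3)] clean_clique_mem[OF assms(1,2)] assms(4)
  by (auto simp: idempotent_mult_self)

text \<open>A second element of a fibre would carry the inverse of the first unit, but an involutive
  unit is its own inverse.\<close>

lemma clean_clique_inj_on_fst:
  assumes "clean_clique K" "snd ` K \<inter> noninvolutive_units = {}"
  shows "inj_on fst K"
proof (rule inj_onI, clarsimp)
  fix e u v assume K: "(e, u) \<in> K" "(e, v) \<in> K"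
  have "u * u = 1"
    using K assms clean_clique_mem[OF assms(1) K(1)] by (force simp: noninvolutive_units_iff)
  then show "u = v" using clean_clique_fibre[OF assms(1) K] inverse_unique[of u u v] by blast
qed

lemma clean_clique_times_one:
  "E \<subseteq> idempotents - {0} \<Longrightarrow> clean_clique (E \<times> {1})"
  by (auto simp: clean_clique_def)

lemma nontrivial_idempotents_clique: "clean_clique (nontrivial_idempotents \<times> {1})"
  by (rule clean_clique_times_one) (auto simp: nontrivial_idempotents_iff)

text \<open>Different idempotents are joined by orthogonality, equal ones by the inverse units. For
  \<open>u\<close> and \<open>v\<close> distinct, this realizes the bound \<open>2n\<close>.\<close>

lemma clean_clique_times_inverse_pair:
  assumes "orthogonal_idempotents P" "u \<in> ring_units" "v \<in> ring_units" "u * v = 1"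
  shows "clean_clique ((P - {0}) \<times> {u, v})"
proof -
  have "e * f = 0" if "e \<in> P" "f \<in> P" "e \<noteq> f" for e f
    using assms(1) that by (auto simp: orthogonal_idempotents_def)
  moreover have "P \<subseteq> idempotents" "v * u = 1"
    using assms by (auto simp: orthogonal_idempotents_def mult.commute)
  ultimately show ?thesis
    using assms(2-4) unfolding clean_clique_def by auto
qed

section \<open>Maximum orthogonal sets and the size of cliques\<close>

lemma ex_maximum_orthogonal_idempotents:
  assumes "finite (idempotents :: 'a::comm_ring_1 set)"
  shows "\<exists>P :: 'a set. maximum_orthogonal_idempotents P"
proof -
  let ?\<P> = "{P :: 'a set. orthogonal_idempotents P}"
  have sub: "?\<P> \<subseteq> Pow idempotents" by (auto simp: orthogonal_idempotents_def)
  then have "finite ?\<P>" using assms by (meson finite_Pow_iff finite_subset)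
  moreover have "{} \<in> ?\<P>" by (auto simp: orthogonal_idempotents_def)
  ultimately have "finite (card ` ?\<P>)" "card ` ?\<P> \<noteq> {}" by blast+
  from Max_in[OF this] Max_ge[OF this(1)]
  obtain P where P: "P \<in> ?\<P>" "\<forall>Q \<in> ?\<P>. card Q \<le> card P" by auto
  have "finite Q" if "Q \<in> ?\<P>" for Q using that sub assms by (meson PowD finite_subset subsetD)
  with P show ?thesis by (auto simp: maximum_orthogonal_idempotents_def ecard_def)
qed

context
  fixes P :: "'a::comm_ring_1 set"
  assumes finite_idempotents: "finite (idempotents :: 'a set)"
    and P: "maximum_orthogonal_idempotents P"
begin

lemma finite_maximum_orthogonal: "finite P"
  using P finite_idempotents
  by (auto simp: maximum_orthogonal_idempotents_def orthogonal_idempotents_def intro: finite_subset)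

lemma card_orthogonal_le:
  fixes Q :: "'a set"
  assumes "Q \<subseteq> idempotents - {0}" "\<And>e f. e \<in> Q \<Longrightarrow> f \<in> Q \<Longrightarrow> e \<noteq> f \<Longrightarrow> e * f = 0"
  shows "card Q \<le> card (P - {0})"
proof -
  have "finite Q" using assms(1) finite_idempotents by (meson finite_Diff finite_subset)
  \<comment> \<open>Maximality of \<open>P\<close> counts 0, the claim does not. Adjoining 0 to
    \<open>Q\<close> balances this: \<open>card Q + 1\<close> is at most \<open>card P\<close>,
    which is at most \<open>card (P - {0}) + 1\<close>.\<close>
  have "orthogonal_idempotents (insert 0 Q)"
    using assms by (auto simp: orthogonal_idempotents_def)
  then have "ecard (insert 0 Q) \<le> ecard P" using P by (simp add: maximum_orthogonal_idempotents_def)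
  then have "card (insert 0 Q) \<le> card P"
    using \<open>finite Q\<close> finite_maximum_orthogonal by (simp add: ecard_def)
  moreover have "0 \<notin> Q" using assms by auto
  moreover have "card P \<le> Suc (card (P - {0}))"
    using finite_maximum_orthogonal by (metis card_Suc_Diff1 diff_le_self card_Diff_singleton_if order_refl le_SucI)
  ultimately show ?thesis using \<open>finite Q\<close> by simp
qed

lemma two_le_card_maximum_orthogonal:
  assumes "(c::'a) \<in> nontrivial_idempotents"
  shows "2 \<le> card (P - {0})"
proof -
  have c: "c \<in> idempotents" "c \<noteq> 0" "c \<noteq> 1" "c * (1 - c) = 0" "(1 - c) * c = 0"
    using assms idempotent_mult_complement[of c] by (auto simp: nontrivial_idempotents_iff mult.commute)
  moreover have "c \<noteq> 1 - c" using c idempotent_mult_self[of c] by metis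
  moreover have "card {c, 1 - c} \<le> card (P - {0})"
    by (rule card_orthogonal_le) (use c in auto)
  ultimately show ?thesis by simp
qed

text \<open>If 1 were in \<open>P\<close>, orthogonality to 1 would leave no other nonzero element,
  whereas \<open>c\<close> and \<open>1 - c\<close> already give two.\<close>

lemma maximum_orthogonal_nontrivial:
  assumes "(c::'a) \<in> nontrivial_idempotents"
  shows "P - {0} \<subseteq> nontrivial_idempotents"
proof -
  have O: "orthogonal_idempotents P" using P by (simp add: maximum_orthogonal_idempotents_def)
  have "1 \<notin> P"
  proof
    assume "1 \<in> P"
    then have "P - {0} \<subseteq> {1}" using O by (fastforce simp: orthogonal_idempotents_def)
    then have "card (P - {0}) \<le> 1" by (metis card_mono card.empty card_insert_disjoint finite.intros One_nat_def empty_iff)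
    then show False using two_le_card_maximum_orthogonal[OF assms] by simp
  qed
  then show ?thesis using O by (auto simp: orthogonal_idempotents_def nontrivial_idempotents_iff)
qed

text \<open>The idempotents over which a clique has two elements form a set \<open>D\<close> that is orthogonal to
  every other idempotent occurring in the clique. If another idempotent \<open>s\<close> occurs, then
  the sums \<open>d + s\<close> with \<open>d \<in> D\<close> are new, and they pay for the second elements of the fibres.\<close>

lemma card_clean_clique_le:
  fixes K :: "('a \<times> 'a) set"
  assumes K: "clean_clique K"
  shows "finite K"
    and "card K \<le> max (2 * card (P - {0})) (max (card (nontrivial_idempotents :: 'a set)) (card (fst ` K)))"
proof -
  define E where "E = fst ` K"
  define D where "D = {e. \<exists>u v. (e, u) \<in> K \<and> (e, v) \<in> K \<and> u \<noteq> v}"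
  \<comment> \<open>The function \<open>g\<close> picks one unit in each fibre and \<open>h\<close>
    the other one; \<open>g\<close> is meaningful on \<open>E\<close> only and \<open>h\<close> on
    \<open>D\<close> only.\<close>
  define g where "g e = (SOME u. (e, u) \<in> K)" for e
  define h where "h e = (SOME v. (e, v) \<in> K \<and> v \<noteq> g e)" for e
  have E_sub: "E \<subseteq> idempotents - {0}" using clean_clique_mem[OF K] by (auto simp: E_def)
  then have finE: "finite E" using finite_idempotents by (meson finite_Diff finite_subset)
  have DE: "D \<subseteq> E" by (force simp: D_def E_def)
  then have finD: "finite D" using finE finite_subset by blast
  have g: "(e, g e) \<in> K" if "(e, u) \<in> K" for e u
    unfolding g_def using that by (rule someI)
  have "(e, u) \<in> (\<lambda>e. (e, g e)) ` E \<union> (\<lambda>e. (e, h e)) ` D" if eu: "(e, u) \<in> K" for e u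
  proof (cases "u = g e")
    case True
    moreover have "e \<in> E" using eu image_eqI[of e fst "(e, u)" K] by (simp add: E_def)
    ultimately show ?thesis by (intro UnI1 image_eqI[of _ _ e]) simp_all
  next
    case False
    then have "(e, h e) \<in> K \<and> h e \<noteq> g e"
      unfolding h_def using eu by (intro someI_ex[of "\<lambda>v. (e, v) \<in> K \<and> v \<noteq> g e"]) blast
    then have "g e * h e = 1" "g e * u = 1"
      using clean_clique_fibre[OF K g[OF eu]] eu False by auto
    then have "u = h e" using inverse_unique by blast
    moreover have "e \<in> D" using eu g[OF eu] False by (auto simp: D_def)
    ultimately show ?thesis by (intro UnI2 image_eqI[of _ _ e]) simp_all
  qed
  then have cover: "K \<subseteq> (\<lambda>e. (e, g e)) ` E \<union> (\<lambda>e. (e, h e)) ` D" by auto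
  then show "finite K" using finE finD by (meson finite_UnI finite_imageI finite_subset)
  have "card K \<le> card ((\<lambda>e. (e, g e)) ` E \<union> (\<lambda>e. (e, h e)) ` D)"
    using cover finE finD by (intro card_mono) auto
  also have "\<dots> \<le> card E + card D"
    by (rule order_trans[OF card_Un_le]) (intro add_mono card_image_le finE finD)
  finally have cardK: "card K \<le> card E + card D" .
  \<comment> \<open>Otherwise a unit over \<open>f\<close> would be inverse to both distinct units
    over \<open>d\<close>.\<close>
  have orth: "d * f = 0" if d: "d \<in> D" and f: "f \<in> E" "f \<noteq> d" for d f
  proof -
    obtain u v w where uvw: "(d, u) \<in> K" "(d, v) \<in> K" "u \<noteq> v" "(f, w) \<in> K"
      using d f by (auto simp: D_def E_def)
    then have "d * f = 0 \<or> w * u = 1 \<and> w * v = 1"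
      using clean_cliqueD[OF K] f by (metis mult.commute prod.inject)
    then show ?thesis using uvw inverse_unique by blast
  qed
  have idem: "e * e = e" "e \<noteq> 0" if "e \<in> E" for e
    using that E_sub idempotent_mult_self by auto
  consider "D = {}" | "E = D" | "D \<noteq> {}" "E - D \<noteq> {}" using DE by blast
  then show "card K \<le> max (2 * card (P - {0})) (max (card (nontrivial_idempotents :: 'a set)) (card (fst ` K)))"
  proof cases
    case 1
    then show ?thesis using cardK by (simp add: E_def)
  next
    case 2
    have "card D \<le> card (P - {0})" using E_sub orth 2 by (intro card_orthogonal_le) auto
    then show ?thesis using cardK 2 by simp
  next
    case 3
    \<comment> \<open>If 1 occurs, then every \<open>d\<close> in \<open>D\<close> equals 1, as it
      is not orthogonal to 1. But then no further \<open>s\<close> can be orthogonal to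
      \<open>d\<close>.\<close>
    have "1 \<notin> E"
    proof
      assume "1 \<in> E"
      obtain d s where ds: "d \<in> D" "s \<in> E - D" using 3 by blast
      then have "d = 1" using orth[OF _ \<open>1 \<in> E\<close>] idem DE by force
      then show False using orth[of d s] ds idem by auto
    qed
    then have E_nontriv: "E \<subseteq> nontrivial_idempotents"
      using E_sub by (auto simp: nontrivial_idempotents_iff)
    have finN: "finite (nontrivial_idempotents :: 'a set)"
      using finite_idempotents by (rule finite_nontrivial_idempotents)
    show ?thesis
    proof (cases "\<exists>s \<in> E - D. \<forall>d \<in> D. d + s \<noteq> 1")
      case True
      then obtain s where s: "s \<in> E - D" "\<forall>d \<in> D. d + s \<noteq> 1" by blast
      \<comment> \<open>Thus \<open>d + s\<close> is not orthogonal to \<open>d\<close>, so by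
        \<open>orth\<close> it could lie in \<open>E\<close> only if it were \<open>d\<close>
        itself, forcing \<open>s = 0\<close>.\<close>
      have absorb: "d * (d + s) = d" if "d \<in> D" for d
      proof -
        have "d * s = 0" "d * d = d" using orth[OF that, of s] s that idem DE by blast+
        then show ?thesis by (simp add: distrib_left)
      qed
      have "d + s \<in> nontrivial_idempotents - E" if d: "d \<in> D" for d
      proof -
        have "d * s = 0" using orth d s by auto
        then have "(d + s) * (d + s) = d + s"
          using idem d s DE by (simp add: algebra_simps subset_iff)
        moreover have "d \<noteq> 0" using idem d DE by blast
        then have "d + s \<noteq> 0" using absorb[OF d] by auto
        moreover have "d + s \<notin> E"
        proof
          assume "d + s \<in> E"
          then have "d + s = d" using orth[OF d] absorb[OF d] \<open>d \<noteq> 0\<close> by metis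
          then show False using s idem by auto
        qed
        ultimately show ?thesis using s d by (auto simp: nontrivial_idempotents_iff idempotents_def)
      qed
      then have sub: "E \<union> (\<lambda>d. d + s) ` D \<subseteq> nontrivial_idempotents"
        and disj: "E \<inter> (\<lambda>d. d + s) ` D = {}" using E_nontriv by auto
      have "card E + card D = card (E \<union> (\<lambda>d. d + s) ` D)"
        using finE finD disj by (subst card_Un_disjoint) (auto simp: card_image inj_on_def)
      also have "\<dots> \<le> card (nontrivial_idempotents :: 'a set)" using sub finN by (rule card_mono[rotated])
      finally show ?thesis using cardK by simp
    next
      case False
      \<comment> \<open>Every \<open>s\<close> in \<open>E - D\<close> now has its complement in
        \<open>D\<close>. Orthogonality leaves only \<open>d0\<close> and \<open>s0\<close>, so
        \<open>K\<close> has at most 3 elements, while \<open>2n\<close> is at least 4.\<close>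
      obtain s0 where s0: "s0 \<in> E - D" using 3 by blast
      then obtain d0 where d0: "d0 \<in> D" "d0 + s0 = 1" using False by blast
      have D1: "d = d0" if "d \<in> D" for d
      proof (rule ccontr)
        assume "d \<noteq> d0"
        then have "d * d0 = 0" "d * s0 = 0" using orth that d0 s0 DE by auto
        then have "d * (d0 + s0) = 0" by (simp add: distrib_left)
        then show False using d0 that idem DE by auto
      qed
      have E1: "s = s0" if "s \<in> E - D" for s
        using False that D1 d0 by (metis add_left_cancel)
      have "E \<subseteq> {d0, s0}" "D \<subseteq> {d0}" using D1 E1 by auto
      then have "card E \<le> 2" "card D \<le> 1"
        using card_mono[of "{d0, s0}" E] card_mono[of "{d0}" D]
        by (auto simp: card_insert_if split: if_splits)
      moreover have "2 \<le> card (P - {0})"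
        using two_le_card_maximum_orthogonal E_nontriv s0 by blast
      ultimately show ?thesis using cardK by simp
    qed
  qed
qed

end

section \<open>Independence numbers\<close>

context
  fixes c t :: "'a::comm_ring_1"
  assumes c: "c \<in> nontrivial_idempotents"
    and t: "t \<in> ring_units" "t \<noteq> 1"
begin

text \<open>Two vertices over 0 are MMD, so at most one of them occurs; it is covered by
  \<open>z\<close>, and the rest is a clique.\<close>

lemma independent_set_SR_clean_graphD:
  fixes S :: "('a \<times> 'a) set"
  assumes "independent_set (strong_resolving_graph clean_graph) S"
  obtains z K where "S \<subseteq> insert z K" "clean_clique K"
proof -
  have S: "S \<subseteq> idempotents \<times> ring_units"
    and *: "\<And>e u f v. (e, u) \<in> S \<Longrightarrow> (f, v) \<in> S \<Longrightarrow> (e, u) \<noteq> (f, v) \<Longrightarrow>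
      (e * f = 0 \<or> u * v = 1) \<and> (e \<noteq> 0 \<or> f \<noteq> 0)"
    using assms unfolding independent_set_SR_clean_graph_iff[OF c t] by fast+
  define K where "K = {(e, u) \<in> S. e \<noteq> 0}"
  have "clean_clique K" using S * unfolding clean_clique_def K_def by auto
  have "\<exists>z. S - K \<subseteq> {z}"
  proof -
    have "x = y" if xy: "x \<in> S - K" "y \<in> S - K" for x y
    proof -
      obtain p q where "x = (0, p)" "y = (0, q)" using xy by (cases x; cases y) (auto simp: K_def)
      then show ?thesis using *[of 0 p 0 q] xy by auto
    qed
    then show ?thesis by blast
  qed
  then obtain z where "S \<subseteq> insert z K" by blast
  then show ?thesis using that \<open>clean_clique K\<close> by blast
qed

lemma independent_set_SR_clean_graphI:
  assumes "clean_clique (K :: ('a \<times> 'a) set)"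
  shows "independent_set (strong_resolving_graph clean_graph) (insert (0, 1) K)"
  using assms unfolding independent_set_SR_clean_graph_iff[OF c t] clean_clique_def by auto

text \<open>Two members over 1 must carry inverse units, so there are at most two. If there are two,
  their units are noninvolutive, and \<open>(1, u)\<close> excludes every \<open>(f, u)\<close> with
  \<open>f\<close> nontrivial.\<close>

lemma independent_set_SR_clean_graph2D:
  fixes S :: "('a \<times> 'a) set"
  assumes "independent_set (strong_resolving_graph clean_graph2) S"
  obtains B u where "clean_clique B" "fst ` B \<subseteq> nontrivial_idempotents" "S \<subseteq> insert (1, u) B"
  | B u v where "clean_clique B" "fst ` B \<subseteq> nontrivial_idempotents" "S = insert (1, u) (insert (1, v) B)"
    "u \<noteq> v" "u * v = 1" "u \<in> noninvolutive_units" "v \<in> noninvolutive_units" "u \<notin> snd ` B" "v \<notin> snd ` B"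
proof -
  have S: "S \<subseteq> (idempotents - {0}) \<times> ring_units"
    and *: "\<And>e u f v. (e, u) \<in> S \<Longrightarrow> (f, v) \<in> S \<Longrightarrow> (e, u) \<noteq> (f, v) \<Longrightarrow>
      e * f = 0 \<or> u * v = 1 \<or> (e = 1) \<noteq> (f = 1) \<and> u \<noteq> v"
    using assms unfolding independent_set_SR_clean_graph2_iff[OF c t] by fast+
  define B where "B = {(e, u) \<in> S. e \<noteq> 1}"
  have "e * f = 0 \<or> u * v = 1" if "(e, u) \<in> B" "(f, v) \<in> B" "(e, u) \<noteq> (f, v)" for e u f v
    using *[of e u f v] that by (auto simp: B_def)
  moreover have "B \<subseteq> (idempotents - {0}) \<times> ring_units" using S by (auto simp: B_def)
  ultimately have B: "clean_clique B"
    unfolding clean_clique_def Ball_def split_paired_All prod.case by blast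
  have B': "fst ` B \<subseteq> nontrivial_idempotents"
    using S by (auto simp: B_def nontrivial_idempotents_iff)
  show ?thesis
  proof (cases "\<exists>u v. (1, u) \<in> S \<and> (1, v) \<in> S \<and> u \<noteq> v")
    case True
    then obtain u v where uv: "(1, u) \<in> S" "(1, v) \<in> S" "u \<noteq> v" by blast
    have one: "(1::'a) \<noteq> 0" using S uv by auto
    have inv: "p * q = 1" if "(1, p) \<in> S" "(1, q) \<in> S" "p \<noteq> q" for p q
      using *[OF that(1,2)] that(3) one by auto
    have "w = v" if "(1, w) \<in> S" "w \<noteq> u" for w
      using inv[OF uv] inv[OF uv(1) that(1)] that(2) inverse_unique[of u w v] by blast
    then have "x \<in> insert (1, u) (insert (1, v) B)" if "x \<in> S" for x
      using that by (cases x) (auto simp: B_def)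
    then have 1: "S = insert (1, u) (insert (1, v) B)" using uv(1,2) by (fastforce simp: B_def)
    have uv1: "u * v = 1" "v * u = 1" using inv uv by auto
    have sq: "u * u \<noteq> 1" "v * v \<noteq> 1" using uv1 uv(3) inverse_unique[of u u v] inverse_unique[of v u v] by blast+
    have "p \<notin> snd ` B" if p: "(1, p) \<in> S" "p * p \<noteq> 1" for p
    proof
      assume "p \<in> snd ` B"
      then obtain f where "(f, p) \<in> S" "f \<noteq> 1" by (auto simp: B_def)
      then show False using *[of 1 p f p] p S by auto
    qed
    then show ?thesis using that(2)[OF B B' 1 uv(3) uv1(1)] uv sq S
      by (auto simp: noninvolutive_units_iff)
  next
    case False
    then obtain u where "\<forall>w. (1, w) \<in> S \<longrightarrow> w = u" by blast
    then have "S \<subseteq> insert (1, u) B" by (auto simp: B_def)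
    then show ?thesis by (rule that(1)[OF B B'])
  qed
qed

text \<open>The vertex \<open>(1, 1)\<close> fits with any such \<open>B\<close>: a member with unit
  1 is adjacent to it, and one with another unit forms a mixed pair with different units.\<close>

lemma independent_set_SR_clean_graph2I1:
  assumes "clean_clique (B :: ('a \<times> 'a) set)" "fst ` B \<subseteq> nontrivial_idempotents"
  shows "independent_set (strong_resolving_graph clean_graph2) (insert (1, 1) B)"
proof -
  have "(1::'a) \<noteq> 0" using c by (metis mult_1 mult_zero_left nontrivial_idempotents_iff)
  moreover have "f \<noteq> 1" if "(f, v) \<in> B" for f v
    using assms(2) that by (force simp: nontrivial_idempotents_iff)
  ultimately show ?thesis using assms(1)
    unfolding independent_set_SR_clean_graph2_iff[OF c t] clean_clique_def by auto
qed

lemma independent_set_SR_clean_graph2I2: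
  assumes "clean_clique (B :: ('a \<times> 'a) set)" "fst ` B \<subseteq> nontrivial_idempotents"
    and "u \<in> ring_units" "v \<in> ring_units" "u * v = 1" "u \<notin> snd ` B" "v \<notin> snd ` B"
  shows "independent_set (strong_resolving_graph clean_graph2) (insert (1, u) (insert (1, v) B))"
proof -
  have "(1::'a) \<noteq> 0" using c by (metis mult_1 mult_zero_left nontrivial_idempotents_iff)
  moreover have "f \<noteq> 1 \<and> w \<noteq> u \<and> w \<noteq> v" if "(f, w) \<in> B" for f w
    using assms(2,6,7) that by (force simp: nontrivial_idempotents_iff)
  moreover have "v * u = 1" using assms by (simp add: mult.commute)
  ultimately show ?thesis using assms(1,3-5)
    unfolding independent_set_SR_clean_graph2_iff[OF c t] clean_clique_def by auto
qed

lemma independence_number_SR_infinite: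
  assumes "infinite (idempotents :: 'a set)"
  shows "independence_number (strong_resolving_graph (clean_graph :: ('a \<times> 'a) sgraph)) = \<infinity>"
    and "independence_number (strong_resolving_graph (clean_graph2 :: ('a \<times> 'a) sgraph)) = \<infinity>"
proof -
  let ?B = "(nontrivial_idempotents :: 'a set) \<times> {1::'a}"
  have "infinite (nontrivial_idempotents :: 'a set)" using assms by (simp add: nontrivial_idempotents_def)
  then have inf: "infinite ?B" by (metis finite_cartesian_productD1 insert_not_empty)
  have B: "clean_clique ?B" by (rule nontrivial_idempotents_clique)
  from independence_number_geI[OF independent_set_SR_clean_graphI[OF B]] inf
  show "independence_number (strong_resolving_graph (clean_graph :: ('a \<times> 'a) sgraph)) = \<infinity>"
    by (simp add: ecard_def)
  have "fst ` ?B \<subseteq> nontrivial_idempotents" by auto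
  from independence_number_geI[OF independent_set_SR_clean_graph2I1[OF B this]] inf
  show "independence_number (strong_resolving_graph (clean_graph2 :: ('a \<times> 'a) sgraph)) = \<infinity>"
    by (simp add: ecard_def)
qed

section \<open>Independence numbers when there are finitely many idempotents\<close>

context
  fixes P :: "'a set"
  assumes finite_idempotents: "finite (idempotents :: 'a set)"
    and P: "maximum_orthogonal_idempotents P"
begin

lemma card_nonzero_idempotents:
  "card (idempotents - {0} :: 'a set) = Suc (card (nontrivial_idempotents :: 'a set))"
proof -
  have "(1::'a) \<noteq> 0" using c by (metis mult_1 mult_zero_left nontrivial_idempotents_iff)
  then have "idempotents - {0} = insert 1 (nontrivial_idempotents :: 'a set)"
    by (auto simp: nontrivial_idempotents_iff)
  then show ?thesis using finite_nontrivial_idempotents[OF finite_idempotents] by (simp add: nontrivial_idempotents_iff)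
qed

lemma orthogonal_clique:
  fixes u v :: 'a
  assumes "u \<in> ring_units" "v \<in> ring_units" "u * v = 1" "u \<noteq> v"
  shows "clean_clique ((P - {0}) \<times> {u, v})" "fst ` ((P - {0}) \<times> {u, v}) \<subseteq> nontrivial_idempotents"
    "card ((P - {0}) \<times> {u, v}) = 2 * card (P - {0})" "finite ((P - {0}) \<times> {u, v})"
proof -
  show "clean_clique ((P - {0}) \<times> {u, v})"
    using assms P by (intro clean_clique_times_inverse_pair) (auto simp: maximum_orthogonal_idempotents_def)
  show "fst ` ((P - {0}) \<times> {u, v}) \<subseteq> nontrivial_idempotents"
    using maximum_orthogonal_nontrivial[OF finite_idempotents P c] by auto
  show "card ((P - {0}) \<times> {u, v}) = 2 * card (P - {0})"
    using assms by (simp add: card_cartesian_product)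
  show "finite ((P - {0}) \<times> {u, v})"
    using finite_maximum_orthogonal[OF finite_idempotents P] by simp
qed

text \<open>The number of occurring idempotents is at most \<open>N + 1\<close>, and at most
  \<open>N\<close> if 1 does not occur; injectivity of \<open>fst\<close> removes the term
  \<open>2n\<close>.\<close>

lemma clean_clique_le:
  assumes "clean_clique (K :: ('a \<times> 'a) set)"
  shows "finite K" "card K \<le> max (2 * card (P - {0})) (Suc (card (nontrivial_idempotents :: 'a set)))"
    and "fst ` K \<subseteq> nontrivial_idempotents \<Longrightarrow>
      card K \<le> max (2 * card (P - {0})) (card (nontrivial_idempotents :: 'a set))"
    and "inj_on fst K \<Longrightarrow> card K \<le> Suc (card (nontrivial_idempotents :: 'a set))"
    and "inj_on fst K \<Longrightarrow> fst ` K \<subseteq> nontrivial_idempotents \<Longrightarrow>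
      card K \<le> card (nontrivial_idempotents :: 'a set)"
proof -
  note bound = card_clean_clique_le[OF finite_idempotents P assms]
  show "finite K" by (rule bound)
  have "fst ` K \<subseteq> idempotents - {0}" using clean_clique_mem[OF assms] by auto
  then have 1: "card (fst ` K) \<le> Suc (card (nontrivial_idempotents :: 'a set))"
    unfolding card_nonzero_idempotents[symmetric] using finite_idempotents by (intro card_mono) auto
  then show "card K \<le> max (2 * card (P - {0})) (Suc (card (nontrivial_idempotents :: 'a set)))"
    using bound(2) by linarith
  have 2: "fst ` K \<subseteq> nontrivial_idempotents \<Longrightarrow> card (fst ` K) \<le> card (nontrivial_idempotents :: 'a set)"
    using finite_nontrivial_idempotents[OF finite_idempotents] by (rule card_mono)
  then show "fst ` K \<subseteq> nontrivial_idempotents \<Longrightarrow>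
      card K \<le> max (2 * card (P - {0})) (card (nontrivial_idempotents :: 'a set))"
    using bound(2) by linarith
  show "inj_on fst K \<Longrightarrow> card K \<le> Suc (card (nontrivial_idempotents :: 'a set))"
    using 1 by (simp add: card_image)
  show "inj_on fst K \<Longrightarrow> fst ` K \<subseteq> nontrivial_idempotents \<Longrightarrow>
      card K \<le> card (nontrivial_idempotents :: 'a set)"
    using 2 by (simp add: card_image)
qed

lemma independence_number_SR_clean_graph_ge:
  "enat (card (nontrivial_idempotents :: 'a set) + 2) \<le>
     independence_number (strong_resolving_graph (clean_graph :: ('a \<times> 'a) sgraph))"
proof -
  have "card (insert (0, 1) ((idempotents - {0} :: 'a set) \<times> {1::'a})) = card (nontrivial_idempotents :: 'a set) + 2"
    using finite_idempotents by (simp add: card_nonzero_idempotents)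
  then show ?thesis
    using independence_number_geI[OF independent_set_SR_clean_graphI[OF clean_clique_times_one[OF order_refl]]]
      finite_idempotents by (simp add: ecard_def)
qed

text \<open>All fibres are singletons. In \<open>clean_graph\<close> a clique of size
  \<open>N + 1\<close> is extended by \<open>(0, 1)\<close>. In \<open>clean_graph2\<close> two
  vertices over 1 never occur together, so only \<open>(1, 1)\<close> is added to a clique of size
  \<open>N\<close>.\<close>

lemma independence_number_SR_involutive:
  assumes "noninvolutive_units = ({} :: 'a set)"
  shows "independence_number (strong_resolving_graph (clean_graph :: ('a \<times> 'a) sgraph)) =
      enat (card (nontrivial_idempotents :: 'a set) + 2)"
    and "independence_number (strong_resolving_graph (clean_graph2 :: ('a \<times> 'a) sgraph)) =
      enat (card (nontrivial_idempotents :: 'a set) + 1)"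
proof -
  let ?N = "card (nontrivial_idempotents :: 'a set)"
  have inj: "inj_on fst K" if "clean_clique (K :: ('a \<times> 'a) set)" for K
    using clean_clique_inj_on_fst[OF that] assms by simp
  show "independence_number (strong_resolving_graph (clean_graph :: ('a \<times> 'a) sgraph)) = enat (?N + 2)"
  proof (rule antisym[OF independence_number_leI independence_number_SR_clean_graph_ge])
    fix S :: "('a \<times> 'a) set" assume "independent_set (strong_resolving_graph clean_graph) S"
    then obtain z K where K: "S \<subseteq> insert z K" "clean_clique K"
      by (rule independent_set_SR_clean_graphD)
    then have "ecard S \<le> enat (Suc (Suc ?N))"
      using clean_clique_le[OF K(2)] inj[OF K(2)] by (intro ecard_subset_insert_le) auto
    then show "ecard S \<le> enat (?N + 2)" by simp
  qed
  show "independence_number (strong_resolving_graph (clean_graph2 :: ('a \<times> 'a) sgraph)) = enat (?N + 1)"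
  proof (rule antisym[OF independence_number_leI])
    fix S :: "('a \<times> 'a) set" assume "independent_set (strong_resolving_graph clean_graph2) S"
    then show "ecard S \<le> enat (?N + 1)"
    proof (cases rule: independent_set_SR_clean_graph2D)
      case (1 B u)
      then have "ecard S \<le> enat (Suc ?N)"
        using clean_clique_le[OF 1(1)] inj[OF 1(1)] by (intro ecard_subset_insert_le) auto
      then show ?thesis by simp
    qed (use assms in auto)
  next
    let ?B = "(nontrivial_idempotents :: 'a set) \<times> {1::'a}"
    have "card (insert (1, 1) ?B) = ?N + 1"
      using finite_nontrivial_idempotents[OF finite_idempotents] by (simp add: nontrivial_idempotents_iff)
    moreover have "fst ` ?B \<subseteq> nontrivial_idempotents" by auto
    ultimately show "enat (?N + 1) \<le> independence_number (strong_resolving_graph (clean_graph2 :: ('a \<times> 'a) sgraph))"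
      using independence_number_geI[OF independent_set_SR_clean_graph2I1[OF nontrivial_idempotents_clique]]
        finite_nontrivial_idempotents[OF finite_idempotents] by (simp add: ecard_def)
  qed
qed

context
  fixes u v :: 'a
  assumes u: "u \<in> noninvolutive_units" and v: "v \<in> ring_units" and uv: "u * v = 1"
begin

lemmas inverse_pair = noninvolutive_inverse_pair[OF u v uv]

lemma independence_number_SR_clean_graph:
  "independence_number (strong_resolving_graph (clean_graph :: ('a \<times> 'a) sgraph)) =
     enat (max (2 * card (P - {0}) + 1) (card (nontrivial_idempotents :: 'a set) + 2))"
  (is "?\<beta> = enat ?m")
proof (rule antisym[OF independence_number_leI])
  fix S :: "('a \<times> 'a) set" assume "independent_set (strong_resolving_graph clean_graph) S"
  then obtain z K where K: "S \<subseteq> insert z K" "clean_clique K"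
    by (rule independent_set_SR_clean_graphD)
  then have "ecard S \<le> enat (Suc (max (2 * card (P - {0})) (Suc (card (nontrivial_idempotents :: 'a set)))))"
    using clean_clique_le[OF K(2)] by (intro ecard_subset_insert_le) auto
  also have "\<dots> = enat ?m" by auto
  finally show "ecard S \<le> enat ?m" .
next
  let ?B = "(P - {0}) \<times> {u, v}"
  note B = orthogonal_clique[OF inverse_pair(1) v uv inverse_pair(2)]
  have "card (insert (0, 1) ?B) = 2 * card (P - {0}) + 1"
    using B(3,4) by (subst card_insert_disjoint) auto
  then have "enat (2 * card (P - {0}) + 1) \<le> ?\<beta>"
    using independence_number_geI[OF independent_set_SR_clean_graphI[OF B(1)]] B(4)
    by (simp add: ecard_def)
  then show "enat ?m \<le> ?\<beta>"
    using independence_number_SR_clean_graph_ge by (auto simp: max_def)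
qed

text \<open>Since \<open>u\<close> and \<open>v\<close> differ from 1, both \<open>(1, u)\<close>
  and \<open>(1, v)\<close> can be added to the clique over the unit 1.\<close>

lemma independence_number_SR_clean_graph2_ge:
  "enat (card (nontrivial_idempotents :: 'a set) + 2) \<le>
     independence_number (strong_resolving_graph (clean_graph2 :: ('a \<times> 'a) sgraph))"
proof -
  let ?B = "(nontrivial_idempotents :: 'a set) \<times> {1::'a}"
  have "card (insert (1, u) (insert (1, v) ?B)) = card (nontrivial_idempotents :: 'a set) + 2"
    using finite_nontrivial_idempotents[OF finite_idempotents] inverse_pair
    by (simp add: nontrivial_idempotents_iff)
  moreover have "independent_set (strong_resolving_graph clean_graph2) (insert (1, u) (insert (1, v) ?B))"
    using inverse_pair v uv by (intro independent_set_SR_clean_graph2I2 nontrivial_idempotents_clique) auto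
  ultimately show ?thesis
    using independence_number_geI finite_nontrivial_idempotents[OF finite_idempotents] by (fastforce simp: ecard_def)
qed

text \<open>Using both \<open>(1, u)\<close> and \<open>(1, v)\<close> leaves only involutive units
  for the clique, hence at most \<open>N + 2\<close> elements. With one vertex over 1, the clique
  may use \<open>u\<close> and \<open>v\<close>, but at most one element is added.\<close>

lemma independence_number_SR_clean_graph2_small:
  assumes "noninvolutive_units = {u, v}"
  shows "independence_number (strong_resolving_graph (clean_graph2 :: ('a \<times> 'a) sgraph)) =
     enat (max (2 * card (P - {0}) + 1) (card (nontrivial_idempotents :: 'a set) + 2))"
  (is "?\<beta> = enat ?m")
proof (rule antisym[OF independence_number_leI])
  fix S :: "('a \<times> 'a) set" assume "independent_set (strong_resolving_graph clean_graph2) S"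
  then show "ecard S \<le> enat ?m"
  proof (cases rule: independent_set_SR_clean_graph2D)
    case (1 B x)
    then have "ecard S \<le> enat (Suc (max (2 * card (P - {0})) (card (nontrivial_idempotents :: 'a set))))"
      using clean_clique_le[OF 1(1)] by (intro ecard_subset_insert_le) auto
    also have "\<dots> \<le> enat ?m" by auto
    finally show ?thesis .
  next
    case (2 B x y)
    have "x \<in> {u, v}" "y \<in> {u, v}" using 2(6,7) unfolding assms .
    then have "{u, v} = {x, y}" using 2(4) by auto
    then have "snd ` B \<inter> noninvolutive_units = {}" using 2(8,9) unfolding assms by auto
    then have "card B \<le> card (nontrivial_idempotents :: 'a set)"
      using clean_clique_le[OF 2(1)] 2(2) clean_clique_inj_on_fst[OF 2(1)] by blast
    then have "card S \<le> card (nontrivial_idempotents :: 'a set) + 2" "finite S"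
      using 2 clean_clique_le(1)[OF 2(1)] by (auto simp: card_insert_if)
    then show ?thesis by (simp add: ecard_def)
  qed
next
  let ?B = "(P - {0}) \<times> {u, v}"
  note B = orthogonal_clique[OF inverse_pair(1) v uv inverse_pair(2)]
  have "(1, 1) \<notin> ?B" using inverse_pair by auto
  then have "card (insert (1, 1) ?B) = 2 * card (P - {0}) + 1"
    using B(3,4) by (subst card_insert_disjoint) auto
  then have "enat (2 * card (P - {0}) + 1) \<le> ?\<beta>"
    using independence_number_geI[OF independent_set_SR_clean_graph2I1[OF B(1,2)]] B(4)
    by (simp add: ecard_def)
  then show "enat ?m \<le> ?\<beta>"
    using independence_number_SR_clean_graph2_ge by (auto simp: max_def)
qed

text \<open>A clique of size \<open>2n\<close> can be built from \<open>w\<close> and its inverse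
  instead, which leaves \<open>u\<close> and \<open>v\<close> free for two vertices over 1.\<close>

lemma independence_number_SR_clean_graph2_large:
  assumes w: "w \<in> noninvolutive_units" "w \<notin> {u, v}"
  shows "independence_number (strong_resolving_graph (clean_graph2 :: ('a \<times> 'a) sgraph)) =
     enat (max (2 * card (P - {0})) (card (nontrivial_idempotents :: 'a set)) + 2)"
  (is "?\<beta> = enat (?m + 2)")
proof (rule antisym[OF independence_number_leI])
  fix S :: "('a \<times> 'a) set" assume "independent_set (strong_resolving_graph clean_graph2) S"
  then obtain B x y where B: "clean_clique B" "fst ` B \<subseteq> nontrivial_idempotents"
    "S \<subseteq> insert (1, x) (insert (1, y) B)"
    by (cases rule: independent_set_SR_clean_graph2D) blast+
  have "card (insert (1, y) B) \<le> Suc ?m" "finite (insert (1, y) B)"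
    using clean_clique_le[OF B(1)] B(2) by (auto simp: card_insert_if)
  then show "ecard S \<le> enat (?m + 2)" using ecard_subset_insert_le[OF B(3)] by simp
next
  have "w \<in> ring_units" using w by (simp add: noninvolutive_units_iff)
  then obtain w' where w': "w' \<in> ring_units" "w * w' = 1" by (rule unit_inverse)
  have "w \<noteq> w'" using w w' by (auto simp: noninvolutive_units_iff)
  \<comment> \<open>If the inverse of \<open>w\<close> were \<open>u\<close> or \<open>v\<close>,
    then \<open>w\<close> would be the other of the two.\<close>
  have "w' \<noteq> u" "w' \<noteq> v"
    using inverse_unique[of w' w v] inverse_unique[of w' w u] w w' uv by (auto simp: mult.commute)
  let ?B = "(P - {0}) \<times> {w, w'}"
  note B = orthogonal_clique[OF \<open>w \<in> ring_units\<close> w' \<open>w \<noteq> w'\<close>]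
  have notin: "(1, u) \<notin> insert (1, v) ?B" "(1, v) \<notin> ?B"
    using w \<open>w' \<noteq> u\<close> \<open>w' \<noteq> v\<close> inverse_pair by auto
  have "card (insert (1, u) (insert (1, v) ?B)) = 2 * card (P - {0}) + 2"
    unfolding card_insert_disjoint[OF finite.insertI[OF B(4)] notin(1)]
      card_insert_disjoint[OF B(4) notin(2)] B(3) by simp
  moreover have "independent_set (strong_resolving_graph clean_graph2) (insert (1, u) (insert (1, v) ?B))"
    using inverse_pair v uv w \<open>w' \<noteq> u\<close> \<open>w' \<noteq> v\<close>
    by (intro independent_set_SR_clean_graph2I2 B(1,2)) auto
  ultimately have "enat (2 * card (P - {0}) + 2) \<le> ?\<beta>"
    using independence_number_geI[of _ "insert (1, u) (insert (1, v) ?B)"] B(4)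
    by (simp add: ecard_def)
  then show "enat (?m + 2) \<le> ?\<beta>"
    using independence_number_SR_clean_graph2_ge by (auto simp: max_def)
qed

end

end

end

section \<open>The five cases\<close>

lemma clean_graphs_complete:
  assumes "ring_units = {1 :: 'a::comm_ring_1}" "c \<in> (nontrivial_idempotents :: 'a set)"
  shows "independence_number (strong_resolving_graph (clean_graph :: ('a \<times> 'a) sgraph)) = 1"
    and "independence_number (strong_resolving_graph (clean_graph2 :: ('a \<times> 'a) sgraph)) = 1"
proof -
  have "(1::'a) \<noteq> 0" using assms(2) by (metis mult_1 mult_zero_left nontrivial_idempotents_iff)
  then have V: "(1, 1) \<in> verts clean_graph2" "(c, 1) \<in> verts clean_graph2" "(1, 1) \<noteq> (c, 1 :: 'a)"
    using assms(2) by (auto simp: verts_clean_graph2 nontrivial_idempotents_iff)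
  have "(x, y) \<in> edges clean_graph \<longleftrightarrow> x \<in> verts clean_graph \<and> y \<in> verts clean_graph \<and> x \<noteq> y"
    for x y :: "'a \<times> 'a"
    by (cases x; cases y) (auto simp: verts_clean_graph edges_clean_graph assms(1))
  then show "independence_number (strong_resolving_graph (clean_graph :: ('a \<times> 'a) sgraph)) = 1"
    by (rule independence_number_SR_complete[of _ "(1, 1)" "(c, 1)"])
       (use V in \<open>auto simp: verts_clean_graph verts_clean_graph2\<close>)
  have "(x, y) \<in> edges clean_graph2 \<longleftrightarrow> x \<in> verts clean_graph2 \<and> y \<in> verts clean_graph2 \<and> x \<noteq> y"
    for x y :: "'a \<times> 'a"
    by (cases x; cases y)
       (auto simp: verts_clean_graph2 edges_clean_graph2 edges_clean_graph assms(1))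
  then show "independence_number (strong_resolving_graph (clean_graph2 :: ('a \<times> 'a) sgraph)) = 1"
    using V by (rule independence_number_SR_complete)
qed

text \<open>For finitely many idempotents and more than two noninvolutive units,
  \<open>max (2n + 1) (N + 2)\<close> is compared with \<open>max (2n) N + 2\<close>. The two agree
  if \<open>2n\<close> is at most \<open>N\<close> and differ by one otherwise. A tie
  \<open>2n = N\<close> thus belongs to (iv), and (v) excludes it explicitly.\<close>

theorem theorem3p8:
  fixes Cl Cl2 :: "('a::comm_ring_1 \<times> 'a) sgraph"
    and Id' U U'' :: "'a set"
    and \<beta> :: "('a \<times> 'a) sgraph \<Rightarrow> enat"
    and SR :: "('a \<times> 'a) sgraph \<Rightarrow> ('a \<times> 'a) sgraph"
  defines "Cl \<equiv> clean_graph" and "Cl2 \<equiv> clean_graph2"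
    and "Id' \<equiv> nontrivial_idempotents" and "U \<equiv> ring_units" and "U'' \<equiv> noninvolutive_units"
    and "\<beta> \<equiv> independence_number" and "SR \<equiv> strong_resolving_graph"
  assumes "Id' \<noteq> {}"
  shows
    "(ecard U = 1 \<longrightarrow> \<beta> (SR Cl) = 1 \<and> \<beta> (SR Cl2) = 1) \<and>
     (ecard U \<ge> 2 \<and> U'' = {} \<longrightarrow> \<beta> (SR Cl) = \<beta> (SR Cl2) + 1) \<and>
     (ecard U'' = 2 \<longrightarrow> \<beta> (SR Cl) = \<beta> (SR Cl2)) \<and>
     (\<forall>P. maximum_orthogonal_idempotents P \<and> ecard U'' > 2 \<and>
          max (2 * ecard (P - {0::'a})) (ecard Id') = ecard Id'
        \<longrightarrow> \<beta> (SR Cl) = \<beta> (SR Cl2)) \<and>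
     (\<forall>P. maximum_orthogonal_idempotents P \<and> ecard U'' > 2 \<and>
          max (2 * ecard (P - {0::'a})) (ecard Id') = 2 * ecard (P - {0}) \<and>
          max (2 * ecard (P - {0::'a})) (ecard Id') \<noteq> ecard Id'
        \<longrightarrow> \<beta> (SR Cl) = \<beta> (SR Cl2) - 1)"
proof -
  obtain c :: 'a where c: "c \<in> nontrivial_idempotents" using assms by blast
  have trivial_units: "ring_units = {1 :: 'a}" if "ecard (ring_units :: 'a set) = 1"
  proof -
    have "card (ring_units :: 'a set) = 1"
      using that by (simp add: ecard_def one_enat_def split: if_splits)
    then obtain x :: 'a where "ring_units = {x}" by (rule card_1_singletonE)
    then show ?thesis using one_in_ring_units[where ?'a = 'a] by (metis singletonD)
  qed
  have two_units: "\<exists>t :: 'a. t \<in> ring_units \<and> t \<noteq> 1" if "ecard (ring_units :: 'a set) \<ge> 2"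
  proof (rule ccontr)
    assume "\<nexists>t :: 'a. t \<in> ring_units \<and> t \<noteq> 1"
    then have "ring_units = {1 :: 'a}" using one_in_ring_units by blast
    then have "ecard (ring_units :: 'a set) = ecard {1 :: 'a}" by (rule arg_cong)
    also have "\<dots> = enat 1" by (simp add: ecard_def)
    finally show False using that by (simp add: numeral_eq_enat)
  qed
  have pair: "\<exists>u v :: 'a. u \<in> noninvolutive_units \<and> v \<in> ring_units \<and> u * v = 1"
    if ne: "noninvolutive_units \<noteq> ({} :: 'a set)"
  proof -
    obtain u :: 'a where u: "u \<in> noninvolutive_units" using ne by blast
    then have "u \<in> ring_units" by (simp add: noninvolutive_units_iff)
    then show ?thesis using u unit_inverse by metis
  qed
  have fin_N: "ecard (nontrivial_idempotents :: 'a set) = enat (card (nontrivial_idempotents :: 'a set))"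
    if "finite (idempotents :: 'a set)"
    using that by (simp add: ecard_def nontrivial_idempotents_def)
  have inf_N: "ecard (nontrivial_idempotents :: 'a set) = \<infinity>"
    if "infinite (idempotents :: 'a set)"
    using that by (simp add: ecard_def nontrivial_idempotents_def)
  let ?b1 = "independence_number (strong_resolving_graph (clean_graph :: ('a \<times> 'a) sgraph))"
  let ?b2 = "independence_number (strong_resolving_graph (clean_graph2 :: ('a \<times> 'a) sgraph))"
  let ?N = "card (nontrivial_idempotents :: 'a set)"
  have ii: "?b1 = ?b2 + 1"
    if two: "ecard (ring_units :: 'a set) \<ge> 2" and inv: "noninvolutive_units = ({} :: 'a set)"
  proof -
    obtain t :: 'a where t: "t \<in> ring_units" "t \<noteq> 1" using two_units[OF two] by blast
    show ?thesis
    proof (cases "finite (idempotents :: 'a set)")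
      case True
      obtain P :: "'a set" where P: "maximum_orthogonal_idempotents P"
        using ex_maximum_orthogonal_idempotents[OF True] by blast
      show ?thesis using independence_number_SR_involutive[OF c t True P inv]
        by (simp add: one_enat_def)
    next
      case False
      then show ?thesis using independence_number_SR_infinite[OF c t] by simp
    qed
  qed
  have iii: "?b1 = ?b2" if card2: "ecard (noninvolutive_units :: 'a set) = 2"
  proof -
    have fin: "finite (noninvolutive_units :: 'a set)" "card (noninvolutive_units :: 'a set) = 2"
      using card2 by (auto simp: ecard_def numeral_eq_enat split: if_splits)
    then have "noninvolutive_units \<noteq> ({} :: 'a set)" by auto
    then obtain u v :: 'a where uv: "u \<in> noninvolutive_units" "v \<in> ring_units" "u * v = 1"
      using pair by blast
    note ip = noninvolutive_inverse_pair[OF uv]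
    show ?thesis
    proof (cases "finite (idempotents :: 'a set)")
      case True
      obtain P :: "'a set" where P: "maximum_orthogonal_idempotents P"
        using ex_maximum_orthogonal_idempotents[OF True] by blast
      \<comment> \<open>The inverse of a noninvolutive unit is noninvolutive and different from it,
        so the pair exhausts the two-element set.\<close>
      have "card {u, v} = 2" using ip by simp
      then have "{u, v} = noninvolutive_units"
        using fin ip(5) uv(1) by (intro card_subset_eq) auto
      then show ?thesis
        using independence_number_SR_clean_graph[OF c ip(1,3) True P uv]
          independence_number_SR_clean_graph2_small[OF c ip(1,3) True P uv] by simp
    next
      case False
      then show ?thesis using independence_number_SR_infinite[OF c ip(1,3)] by simp
    qed
  qed
  have large: "\<exists>u v w :: 'a. u \<in> noninvolutive_units \<and> v \<in> ring_units \<and> u * v = 1 \<and>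
      w \<in> noninvolutive_units \<and> w \<notin> {u, v}" if gt2: "ecard (noninvolutive_units :: 'a set) > 2"
  proof -
    have "noninvolutive_units \<noteq> ({} :: 'a set)" using gt2 by (auto simp: ecard_def)
    then obtain u v :: 'a where uv: "u \<in> noninvolutive_units" "v \<in> ring_units" "u * v = 1"
      using pair by blast
    have "\<not> noninvolutive_units \<subseteq> {u, v}"
    proof
      assume sub: "noninvolutive_units \<subseteq> {u, v}"
      then have "card (noninvolutive_units :: 'a set) \<le> card {u, v}" by (intro card_mono) auto
      also have "\<dots> \<le> 2" by (simp add: card_insert_if)
      finally show False using gt2 finite_subset[OF sub] by (simp add: ecard_def numeral_eq_enat)
    qed
    then show ?thesis using uv by blast
  qed
  have iv_v: "finite (idempotents :: 'a set) \<Longrightarrow>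
       ?b1 = enat (max (2 * card (P - {0}) + 1) (?N + 2)) \<and> ?b2 = enat (max (2 * card (P - {0})) ?N + 2) \<and>
       ecard (P - {0}) = enat (card (P - {0}))"
      "infinite (idempotents :: 'a set) \<Longrightarrow> ?b1 = \<infinity> \<and> ?b2 = \<infinity>"
    if P: "maximum_orthogonal_idempotents P" and gt2: "ecard (noninvolutive_units :: 'a set) > 2"
    for P :: "'a set"
  proof -
    obtain u v w :: 'a where uv: "u \<in> noninvolutive_units" "v \<in> ring_units" "u * v = 1"
      and w: "w \<in> noninvolutive_units" "w \<notin> {u, v}" using large[OF gt2] by blast
    note ip = noninvolutive_inverse_pair[OF uv]
    show "infinite (idempotents :: 'a set) \<Longrightarrow> ?b1 = \<infinity> \<and> ?b2 = \<infinity>"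
      using independence_number_SR_infinite[OF c ip(1,3)] by simp
    assume fin: "finite (idempotents :: 'a set)"
    show "?b1 = enat (max (2 * card (P - {0}) + 1) (?N + 2)) \<and> ?b2 = enat (max (2 * card (P - {0})) ?N + 2) \<and>
       ecard (P - {0}) = enat (card (P - {0}))"
      using independence_number_SR_clean_graph[OF c ip(1,3) fin P uv]
        independence_number_SR_clean_graph2_large[OF c ip(1,3) fin P uv w]
        finite_maximum_orthogonal[OF fin P] by (simp add: ecard_def)
  qed
  have iv: "?b1 = ?b2"
    if "maximum_orthogonal_idempotents P" "ecard (noninvolutive_units :: 'a set) > 2"
      "max (2 * ecard (P - {0})) (ecard (nontrivial_idempotents :: 'a set)) = ecard (nontrivial_idempotents :: 'a set)"
    for P :: "'a set"
  proof (cases "finite (idempotents :: 'a set)")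
    case True
    then have "2 * card (P - {0}) \<le> ?N"
      using that(3) iv_v(1)[OF that(1,2)] fin_N by (simp add: numeral_eq_enat max_def split: if_splits)
    then show ?thesis using iv_v(1)[OF that(1,2) True] by (simp add: max_def)
  qed (use iv_v(2)[OF that(1,2)] in simp)
  have v: "?b1 = ?b2 - 1"
    if "maximum_orthogonal_idempotents P" "ecard (noninvolutive_units :: 'a set) > 2"
      "max (2 * ecard (P - {0})) (ecard (nontrivial_idempotents :: 'a set)) \<noteq> ecard (nontrivial_idempotents :: 'a set)"
    for P :: "'a set"
  proof (cases "finite (idempotents :: 'a set)")
    case True
    then have "?N < 2 * card (P - {0})"
      using that(3) iv_v(1)[OF that(1,2)] fin_N by (simp add: numeral_eq_enat max_def split: if_splits)
    then show ?thesis using iv_v(1)[OF that(1,2) True] by (simp add: max_def one_enat_def)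
  next
    case False
    \<comment> \<open>With infinitely many idempotents the maximum is the infinite \<open>N\<close>,
      which the strict case excludes.\<close>
    then show ?thesis using that(3) inf_N by simp
  qed
  show ?thesis
    using clean_graphs_complete[OF trivial_units c] ii iii iv v
    unfolding Cl_def Cl2_def Id'_def U_def U''_def \<beta>_def SR_def by blast
qed

end
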